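(* Let $\{Z(t),t\ge 0\}$ be a critical Markov branching process with infinitesimal generating function $f$, let $0<\nu<1$, and suppose that $f(1-y)=y\Lambda(y)$ for all $y\in(0,1]$, where $\Lambda(y)=y^{\nu}\mathcal{L}(1/y)$ with $\mathcal{L}$ slowly varying at infinity, and that $\dfrac{y\Lambda'(y)}{\Lambda(y)}=\nu+\delta(y)$, where $\delta$ is continuous and $\delta(y)\to 0$ as $y\downarrow 0$. Let $\mathcal{N}(t)$ be the slowly varying function satisfying $$\mathcal{N}^{\nu}(t)\cdot\mathcal{L}\left(\frac{(\nu t)^{1/\nu}}{\mathcal{N}(t)}\right)\longrightarrow 1\qquad\text{as } t\to\infty .$$ Let $\{W(t),t\ge0\}$ be the associated Markov Q-process with transition probabilities $\mathcal{Q}_{ij}(t)$ and state space $\mathcal{E}\subset\mathbb{N}$, and let $G(t;s)=\mathbb{E}[s^{W(t)}\mid W(0)=1]$, $s\in[0,1)$. Then $$(\nu t)^{1+1/\nu}\,G(t;s)=\pi(s)\,\mathcal{N}(t)\bigl(1+\rho(t;s)\bigr),$$ where the function $\pi(s)$ has an expansion $\pi(s)=\sum_{j\in\mathcal{E}}\pi_js^j$ in powers of $s$ with non-negative coefficients and $\{\pi_j,j\in\mathcal{E}\}$ is an invariant measure for the Markov Q-process, i.e. $\pi_j=\sum_{i\in\mathcal{E}}\pi_i\mathcal{Q}_{ij}(t)$. Moreover $$\pi(s)=\frac{s}{(1-s)^{1+\nu}}\,\mathcal{L}_{\pi}\left(\frac{1}{1-s}\right),\qquad \mathcal{L}_{\pi}(x)=\frac{1}{\mathcal{L}(x)}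 .$$ Furthermore $\rho(t;s)=o(1)$ as $t\to\infty$. If in addition $\delta(y)=\Lambda(y)$, then $$\rho(t;s)=-\frac{1+\nu}{\nu^{3}}\,\frac{\ln\left[\Lambda(1-s)\nu t+1\right]}{t}+o\left(\frac{\ln t}{t}\right)\qquad\text{as } t\to\infty .$$
   Context: A Markov branching process (MBP) is a homogeneous continuous-time Markov process $\{Z(t),t\ge0\}$ with state space $\mathcal{S}_0=\{0\}\cup\mathcal{S}$, $\mathcal{S}\subset\mathbb{N}=\{1,2,\dots\}$, whose transition probabilities $P_{ij}(t)=\mathbb{P}\{Z(t)=j\mid Z(0)=i\}$ satisfy the branching property $P_{ij}(t)=P_{1j}^{i*}(t)$ ($i$-fold convolution) and $P_{1j}(\varepsilon)=\delta_{1j}+a_j\varepsilon+o(\varepsilon)$ as $\varepsilon\downarrow0$ ($\delta_{1j}$ is Kronecker's delta), where $a_j\ge0$ for $j\ne1$ and $0<a_0<-a_1=\sum_{j\in\mathcal{S}_0\setminus\{1\}}a_j<\infty$. Its infinitesimal generating function is $f(s)=\sum_{j\in\mathcal{S}_0}a_js^j$, $s\in[0,1)$. The generating function $F(t;s)=\sum_{j\in\mathcal{S}_0}P_{1j}(t)s^j$ is the unique solution of $\partial F/\partial t=f(F)$, $F(0;s)=s$. The process is critical if $f'(1-)=\sum_{j\in\mathcal S}ja_j=0$. Put $R(t;s)=1-F(t;s)$. A positive function $\mathcal{L}$ is slowly varying at infinity (in the sense of Karamata) if $\mathcal{L}(\lambda x)/\mathcal{L}(x)\to1$ as $x\to\infty$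 for every $\lambda>0$. Markov Q-process (MQP): with $\mathcal{H}=\inf\{t:Z(t)=0\}$ the extinction time, the MQP is the continuous-time Markov chain $\{W(t),t\ge0\}$ with state space $\mathcal{E}\subset\mathbb{N}$ and transition probabilities $\mathcal{Q}_{ij}(t)=\lim_{u\to\infty}\mathbb{P}\{Z(t)=j\mid Z(0)=i,\ t+u<\mathcal{H}<\infty\}=\frac{j}{i}P_{ij}(t)$ (critical case). Thus $G(t;s)=\sum_{j\in\mathcal{E}}\mathcal{Q}_{1j}(t)s^j=-s\,\partial R(t;s)/\partial s=s\,f(F(t;s))/f(s)$.
   Formalization: The norming limit fixes N(t) only up to asymptotic equivalence, so the refined expansion of ρ fails for some N; it is stated for those N whose norming expression equals 1+o(ln t/t), and existence of such a slowly varying N is proved when δ=Λ. *)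

theory Defs
  imports "HOL-Probability.Probability" "HOL-Library.Landau_Symbols"
begin

text \<open>
  A Markov chain is given by a family of probability measures \<open>M i\<close>, one for each initial
  state \<open>i\<close>: the law under \<open>M i\<close> is the conditional law given \<open>X 0 = i\<close>.
\<close>

definition trans_prob :: "(nat \<Rightarrow> 'w measure) \<Rightarrow> (real \<Rightarrow> 'w \<Rightarrow> nat) \<Rightarrow> real \<Rightarrow> nat \<Rightarrow> nat \<Rightarrow> real"
  where "trans_prob M X t i j = \<P>(\<omega> in M i. X t \<omega> = j)"

locale homogeneous_markov_chain =
  fixes M :: "nat \<Rightarrow> 'w measure" and X :: "real \<Rightarrow> 'w \<Rightarrow> nat" and E :: "nat set"
  assumes prob_spaces: "i \<in> E \<Longrightarrow> prob_space (M i)"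
    and random_variables: "\<lbrakk>i \<in> E; 0 \<le> t\<rbrakk> \<Longrightarrow> X t \<in> M i \<rightarrow>\<^sub>M count_space UNIV"
    and initial_state: "i \<in> E \<Longrightarrow> AE \<omega> in M i. X 0 \<omega> = i"
    and state_space: "\<lbrakk>i \<in> E; 0 \<le> t\<rbrakk> \<Longrightarrow> AE \<omega> in M i. X t \<omega> \<in> E"
    and markov_property:
      "\<lbrakk>i \<in> E; j \<in> E; k \<in> E; 0 \<le> s; 0 \<le> t; finite T; T \<subseteq> {0..s};
        \<P>(\<omega> in M i. (\<forall>r\<in>T. X r \<omega> = x r) \<and> X s \<omega> = j) > 0\<rbrakk> \<Longrightarrow>
       \<P>(\<omega> in M i. X (s + t) \<omega> = k \<bar> (\<forall>r\<in>T. X r \<omega> = x r) \<and> X s \<omega> = j)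
         = trans_prob M X t j k"

text \<open>
  In the branching property, the \<open>j\<close>-th coefficient of the \<open>i\<close>-th power of the formal power
  series with coefficients \<open>p\<close> is the value at \<open>j\<close> of the \<open>i\<close>-fold convolution of \<open>p\<close>.
  Right-continuity of the paths in the discrete topology makes the extinction time below
  measurable.
\<close>

locale markov_branching_process =
  homogeneous_markov_chain M Z "insert 0 S"
  for M :: "nat \<Rightarrow> 'w measure" and Z :: "real \<Rightarrow> 'w \<Rightarrow> nat" and S :: "nat set" +
  fixes a :: "nat \<Rightarrow> real"
  assumes zero_notin_S: "0 \<notin> S"
    and one_in_S: "1 \<in> S"
    and right_continuous_paths:
      "\<lbrakk>i \<in> insert 0 S; \<omega> \<in> space (M i); 0 \<le> t\<rbrakk> \<Longrightarrow> ((\<lambda>r. Z r \<omega>) \<longlongrightarrow> Z t \<omega>) (at_right t)"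
    and branching_property:
      "\<lbrakk>i \<in> insert 0 S; j \<in> insert 0 S; 0 \<le> t\<rbrakk> \<Longrightarrow>
       trans_prob M Z t i j = fps_nth (Abs_fps (trans_prob M Z t 1) ^ i) j"
    and infinitesimal:
      "j \<in> insert 0 S \<Longrightarrow>
       (\<lambda>\<epsilon>. trans_prob M Z \<epsilon> 1 j - ((if j = 1 then 1 else 0) + a j * \<epsilon>)) \<in> o[at_right 0](\<lambda>\<epsilon>. \<epsilon>)"
    and rates_nonneg: "\<lbrakk>j \<in> insert 0 S; j \<noteq> 1\<rbrakk> \<Longrightarrow> 0 \<le> a j"
    and death_rate: "0 < a 0" "a 0 < - a 1"
    and conservative: "(a has_sum (- a 1)) (insert 0 S - {1})"

definition inf_gen_fun :: "nat set \<Rightarrow> (nat \<Rightarrow> real) \<Rightarrow> real \<Rightarrow> real"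
  where "inf_gen_fun S a s = (\<Sum>\<^sub>\<infinity>j\<in>insert 0 S. a j * s ^ j)"

definition critical :: "nat set \<Rightarrow> (nat \<Rightarrow> real) \<Rightarrow> bool"
  where "critical S a \<longleftrightarrow> ((\<lambda>j. real j * a j) has_sum 0) S"

definition extinction_time :: "(real \<Rightarrow> 'w \<Rightarrow> nat) \<Rightarrow> 'w \<Rightarrow> ereal"
  where "extinction_time Z \<omega> = Inf (ereal ` {t. 0 \<le> t \<and> Z t \<omega> = 0})"

definition Q_trans_prob :: "(nat \<Rightarrow> 'w measure) \<Rightarrow> (real \<Rightarrow> 'w \<Rightarrow> nat) \<Rightarrow> real \<Rightarrow> nat \<Rightarrow> nat \<Rightarrow> real"
  where "Q_trans_prob M Z t i j =
    Lim at_top (\<lambda>u. \<P>(\<omega> in M i. Z t \<omega> = j \<bar>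
      ereal (t + u) < extinction_time Z \<omega> \<and> extinction_time Z \<omega> < \<infinity>))"

locale markov_Q_process =
  homogeneous_markov_chain MW W E
  for M :: "nat \<Rightarrow> 'w measure" and Z :: "real \<Rightarrow> 'w \<Rightarrow> nat" and S :: "nat set"
    and MW :: "nat \<Rightarrow> 'v measure" and W :: "real \<Rightarrow> 'v \<Rightarrow> nat" and E :: "nat set" +
  assumes E_subset_S: "E \<subseteq> S"
    and one_in_E: "1 \<in> E"
    and Q_transitions:
      "\<lbrakk>i \<in> E; j \<in> E; 0 \<le> t\<rbrakk> \<Longrightarrow> trans_prob MW W t i j = Q_trans_prob M Z t i j"

definition gen_fun :: "(nat \<Rightarrow> 'v measure) \<Rightarrow> (real \<Rightarrow> 'v \<Rightarrow> nat) \<Rightarrow> real \<Rightarrow> real \<Rightarrow> real"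
  where "gen_fun M X t s = (\<integral>\<omega>. s ^ X t \<omega> \<partial>M 1)"

definition slowly_varying :: "(real \<Rightarrow> real) \<Rightarrow> bool"
  where "slowly_varying L \<longleftrightarrow>
    (\<forall>x>0. L x > 0) \<and> (\<forall>c>0. ((\<lambda>x. L (c * x) / L x) \<longlongrightarrow> 1) at_top)"

text \<open>
  Convergence of the following ratio to 1 at infinity determines the slowly varying function \<open>N\<close>
  only up to asymptotic equivalence.
\<close>

definition norming_ratio :: "real \<Rightarrow> (real \<Rightarrow> real) \<Rightarrow> (real \<Rightarrow> real) \<Rightarrow> real \<Rightarrow> real"
  where "norming_ratio \<nu> L N t = N t powr \<nu> * L ((\<nu> * t) powr (1 / \<nu>) / N t)"

end

theory Submission
  imports Defs "HOL-Real_Asymp.Real_Asymp"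
begin

text \<open>
  The infinitesimal conditions and the semigroup law \<open>F (s + t) x = F s (F t x)\<close> give
  \<open>\<partial>F/\<partial>t = f (F)\<close> and \<open>f (F) = f \<sqdot> \<partial>F/\<partial>x\<close>. With \<open>R = 1 - F\<close> this reads \<open>R' = - R \<Lambda>(R)\<close>, whence
  \<open>(1 / \<Lambda>(R))' = \<nu> + \<delta>(R)\<close> and \<open>\<Lambda>(R) \<sim> 1 / (\<nu> t)\<close>; the correction is \<open>\<integral> \<delta>(R)\<close>, which is
  \<open>\<nu>\<inverse> ln t\<close> to first order if \<open>\<delta> = \<Lambda>\<close>. By the definition of \<open>N\<close> the scale
  \<open>r = N(t) / (\<nu> t) powr (1/\<nu>)\<close> satisfies the same asymptotic equation as \<open>R\<close>, and since \<open>ln \<Lambda>\<close> has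
  logarithmic slope \<open>\<nu> + \<delta>\<close>, the ratio \<open>R / r\<close> is controlled by \<open>\<Lambda>(R) / \<Lambda>(r)\<close>.
  The transition probabilities of the Q-process are \<open>(j/i) P\<^sub>i\<^sub>j\<close>, so its generating function
  from \<open>1\<close> is \<open>x f(F) / f(x)\<close>, and \<open>\<pi> = x / f(x)\<close>. Invariance of \<open>\<pi>\<close> is the chain rule identity
  \<open>\<Sum>\<^sub>i \<pi>\<^sub>i x F^(i-1) \<partial>F/\<partial>x = x \<partial>F/\<partial>x / f(F) = \<pi>(x)\<close>.
\<close>

subsection \<open>Asymptotics of the decay equation\<close>

text \<open>The differential equations for \<open>F\<close> must be derived: the hypotheses give
  small-time asymptotics of \<open>p h j\<close> for each \<open>j\<close> separately. Uniformity in
  \<open>j\<close> comes from the total mass, since every \<open>p h j\<close> with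
  \<open>j \<noteq> 1\<close> is at most \<open>1 - p h 1\<close>. The resulting expansion is
  uniform only on \<open>[0, x]\<close> with \<open>x < 1\<close>, so \<open>F\<close> must first be
  kept below some bound smaller than 1. Of the state space \<open>E\<close> only
  \<open>1 \<in> E\<close> and \<open>E \<subseteq> S\<close> are assumed. The row of the Q-process
  from 1 has mass 1 on \<open>E\<close>, while the mean of \<open>p t\<close> is at most 1, so
  \<open>p t\<close> vanishes at positive states outside \<open>E\<close>. As every positive integer
  is reached with positive probability, \<open>E\<close> consists of all of them. The constant of
  the second order arises from \<open>ln (\<nu> t \<Lambda>(R)) \<sim> - ln t / (\<nu>^2 t)\<close>.
  This logarithm enters once through \<open>\<Lambda>(R)\<close> and once more, divided by
  \<open>\<nu>\<close>, through the ratio of \<open>R\<close> to the scale; the sum is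
  \<open>-(1 + 1/\<nu>) / \<nu>^2 = -(1 + \<nu>) / \<nu>^3\<close> times
  \<open>ln t / t\<close>.\<close>

lemma difference_quotient_tendsto:
  fixes g :: "real \<Rightarrow> real"
  assumes "DERIV g x :> l" "(e \<longlongrightarrow> x) F"
  obtains h where "\<And>t. g (e t) - g x = h t * (e t - x)" "(h \<longlongrightarrow> l) F"
proof -
  \<comment> \<open>Caratheodory's form of the derivative yields a quotient that is also defined
    where \<open>e t = x\<close>.\<close>
  obtain k where k: "\<And>z. g z - g x = k z * (z - x)" "isCont k x" "k x = l"
    using assms(1) unfolding CARAT_DERIV by auto
  have "((\<lambda>t. k (e t)) \<longlongrightarrow> l) F"
    using isCont_tendsto_compose[OF k(2) assms(2)] k(3) by simp
  then show ?thesis using k(1) by (intro that[of "\<lambda>t. k (e t)"])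
qed

section \<open>Rates with logarithmic slope tending to \<open>\<nu>\<close> at zero\<close>

locale regular_rate =
  fixes \<nu> :: real and \<Lambda> \<Lambda>' \<delta> :: "real \<Rightarrow> real"
  assumes nu_pos: "0 < \<nu>"
    and rate_pos: "\<And>y. y \<in> {0<..1} \<Longrightarrow> 0 < \<Lambda> y"
    and rate_deriv: "\<And>y. y \<in> {0<..1} \<Longrightarrow> (\<Lambda> has_real_derivative \<Lambda>' y) (at y within {0<..1})"
    and delta_eq: "\<And>y. y \<in> {0<..1} \<Longrightarrow> y * \<Lambda>' y / \<Lambda> y = \<nu> + \<delta> y"
    and delta_lim: "(\<delta> \<longlongrightarrow> 0) (at_right 0)"
begin

lemma rate_deriv_at:
  assumes "0 < y" "y < 1"
  shows "(\<Lambda> has_real_derivative \<Lambda>' y) (at y)"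
proof -
  have "(\<Lambda> has_real_derivative \<Lambda>' y) (at y within {0<..<1})"
    using rate_deriv[of y] assms by (auto intro: has_field_derivative_subset)
  then show ?thesis using assms at_within_open[of y "{0<..<1::real}"] by simp
qed

lemma continuous_on_rate: "continuous_on {0<..1} \<Lambda>"
  using rate_deriv by (rule DERIV_continuous_on)

lemma rate_deriv_eq: "y \<in> {0<..1} \<Longrightarrow> \<Lambda>' y = (\<nu> + \<delta> y) * \<Lambda> y / y"
  using delta_eq[of y] rate_pos[of y] by (auto simp: field_simps)

text \<open>In the coordinate \<open>x = ln y\<close> the relation
  \<open>y \<Lambda>' / \<Lambda> = \<nu> + \<delta>\<close> becomes an ordinary derivative, to
  which the mean value theorem applies.\<close>

lemma DERIV_ln_rate_exp:
  assumes "x < 0"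
  shows "((\<lambda>x. ln (\<Lambda> (exp x))) has_real_derivative \<nu> + \<delta> (exp x)) (at x)"
proof -
  have e: "0 < exp x" "exp x < 1" using assms by auto
  have p: "0 < \<Lambda> (exp x)" using rate_pos e by auto
  have "((\<lambda>x. \<Lambda> (exp x)) has_real_derivative \<Lambda>' (exp x) * exp x) (at x)"
    by (rule DERIV_chain2[where f = \<Lambda> and g = exp, OF rate_deriv_at[OF e] DERIV_exp])
  from DERIV_chain2[OF DERIV_ln[OF p] this]
  have "((\<lambda>x. ln (\<Lambda> (exp x))) has_real_derivative 1 / \<Lambda> (exp x) * (\<Lambda>' (exp x) * exp x)) (at x)"
    by (simp add: inverse_eq_divide)
  moreover have "1 / \<Lambda> (exp x) * (\<Lambda>' (exp x) * exp x) = \<nu> + \<delta> (exp x)"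
    using p rate_deriv_eq[of "exp x"] e by simp
  ultimately show ?thesis by simp
qed

text \<open>Mean value theorem in the coordinate \<open>ln y\<close>. The bounds on the intermediate
  point are weak so that \<open>y = z\<close> is covered.\<close>

lemma ln_rate_diff:
  assumes "0 < y" "y < 1" "0 < z" "z < 1"
  shows "\<exists>\<xi>. min y z \<le> \<xi> \<and> \<xi> \<le> max y z \<and>
    ln (\<Lambda> y) - ln (\<Lambda> z) = (\<nu> + \<delta> \<xi>) * (ln y - ln z)"
  using assms
proof (induction y z rule: linorder_wlog)
  case (le y z)
  show ?case
  proof (cases "y = z")
    case False
    then have lt: "ln y < ln z" using le by simp
    obtain x where x: "ln y < x" "x < ln z"
      "ln (\<Lambda> (exp (ln z))) - ln (\<Lambda> (exp (ln y))) = (ln z - ln y) * (\<nu> + \<delta> (exp x))"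
      using MVT2[OF lt, of "\<lambda>x. ln (\<Lambda> (exp x))" "\<lambda>x. \<nu> + \<delta> (exp x)"] DERIV_ln_rate_exp le
      by (smt (verit) ln_less_zero)
    have "y \<le> exp x" "exp x \<le> z" using x le
      by (metis exp_le_cancel_iff exp_ln less_imp_le)+
    then show ?thesis using x(3) le by (intro exI[of _ "exp x"]) (auto simp: algebra_simps)
  qed (use le in auto)
next
  case (sym y z)
  then obtain \<xi> where "min z y \<le> \<xi>" "\<xi> \<le> max z y"
    "ln (\<Lambda> z) - ln (\<Lambda> y) = (\<nu> + \<delta> \<xi>) * (ln z - ln y)" by (auto simp: min.commute max.commute)
  then show ?case by (intro exI[of _ \<xi>]) (auto simp: algebra_simps)
qed

text \<open>Near 0 the logarithmic slope is at least \<open>\<nu> / 2\<close>, so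
  \<open>\<Lambda>\<close> lies below a multiple of \<open>y powr (\<nu> / 2)\<close>.\<close>

lemma rate_tendsto_0: "(\<Lambda> \<longlongrightarrow> 0) (at_right 0)"
proof -
  have "eventually (\<lambda>y. \<bar>\<delta> y\<bar> < \<nu> / 2) (at_right 0)"
    using tendstoD[OF delta_lim, of "\<nu> / 2"] nu_pos by simp
  then obtain b where b: "0 < b" "\<And>y. 0 < y \<Longrightarrow> y < b \<Longrightarrow> \<bar>\<delta> y\<bar> < \<nu> / 2"
    by (auto simp: eventually_at_right_field)
  define c where "c = min b 1 / 2"
  have c: "0 < c" "c < b" "c < 1" using b by (auto simp: c_def)
  have bound: "\<Lambda> y \<le> \<Lambda> c * (y / c) powr (\<nu> / 2)" if y: "0 < y" "y < c" for y
  proof -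
    obtain \<xi> where \<xi>: "min y c \<le> \<xi>" "\<xi> \<le> max y c"
      "ln (\<Lambda> y) - ln (\<Lambda> c) = (\<nu> + \<delta> \<xi>) * (ln y - ln c)"
      using ln_rate_diff[of y c] y c by auto
    have "\<nu> / 2 \<le> \<nu> + \<delta> \<xi>" using b(2)[of \<xi>] \<xi> y c by auto
    \<comment> \<open>The factor \<open>ln y - ln c\<close> is negative, so the lower bound on the
      slope becomes an upper bound on the product.\<close>
    then have "(\<nu> + \<delta> \<xi>) * (ln y - ln c) \<le> \<nu> / 2 * (ln y - ln c)"
      using y by (intro mult_right_mono_neg) auto
    then have "ln (\<Lambda> y) \<le> ln (\<Lambda> c) + \<nu> / 2 * ln (y / c)"
      using \<xi>(3) y c unfolding ln_divide_pos[OF y(1) c(1)] by linarith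
    also have "\<dots> = ln (\<Lambda> c * (y / c) powr (\<nu> / 2))"
      using rate_pos[of c] y c by (simp add: ln_mult ln_powr)
    finally show ?thesis using rate_pos[of c] rate_pos[of y] y c by (subst (asm) ln_le_cancel_iff) auto
  qed
  have "((\<lambda>y. y / c) \<longlongrightarrow> 0 / c) (at_right 0)" by (intro tendsto_intros) (use c in auto)
  moreover have "eventually (\<lambda>y. 0 \<le> y / c) (at_right 0)"
    using c by (auto simp: eventually_at_right_field intro!: exI[of _ 1])
  ultimately have "((\<lambda>y. (y / c) powr (\<nu> / 2)) \<longlongrightarrow> 0) (at_right 0)"
    using tendsto_zero_powrI[of "\<lambda>y. y / c" "at_right 0" "\<lambda>_. \<nu>/2" "\<nu>/2"] nu_pos by auto
  then have lim: "((\<lambda>y. \<Lambda> c * (y / c) powr (\<nu> / 2)) \<longlongrightarrow> 0) (at_right 0)"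
    using tendsto_mult_right_zero by blast
  show ?thesis
  proof (rule tendsto_sandwich[OF _ _ tendsto_const lim])
    show "eventually (\<lambda>y. 0 \<le> \<Lambda> y) (at_right 0)"
      using rate_pos c by (auto simp: eventually_at_right_field intro!: exI[of _ 1] less_imp_le)
    show "eventually (\<lambda>y. \<Lambda> y \<le> \<Lambda> c * (y / c) powr (\<nu> / 2)) (at_right 0)"
      using bound c by (auto simp: eventually_at_right_field intro!: exI[of _ c])
  qed
qed

lemma rate_bounded_below:
  assumes "0 < \<epsilon>" "\<epsilon> \<le> 1"
  obtains m where "0 < m" "\<And>y. y \<in> {\<epsilon>..1} \<Longrightarrow> m \<le> \<Lambda> y"
proof -
  have "continuous_on {\<epsilon>..1} \<Lambda>"
    using continuous_on_rate by (rule continuous_on_subset) (use assms in auto)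
  from continuous_attains_inf[OF compact_Icc _ this] assms
  obtain x where "x \<in> {\<epsilon>..1}" "\<And>y. y \<in> {\<epsilon>..1} \<Longrightarrow> \<Lambda> x \<le> \<Lambda> y" by auto
  then show ?thesis using rate_pos[of x] assms by (intro that[of "\<Lambda> x"]) auto
qed

text \<open>Away from 0 the rate need not be monotone. It is, however, bounded below by a positive
  constant on each \<open>{\<epsilon>..1}\<close>, so a small value forces a small argument.\<close>

lemma filterlim_at_right_0_of_rate:
  assumes y: "eventually (\<lambda>t. y t \<in> {0<..1}) F" and lim: "((\<lambda>t. \<Lambda> (y t)) \<longlongrightarrow> 0) F"
  shows "filterlim y (at_right 0) F"
proof -
  have "eventually (\<lambda>t. \<bar>y t\<bar> < \<epsilon>) F" if "0 < \<epsilon>" for \<epsilon>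
  proof -
    obtain m where m: "0 < m" "\<And>y. y \<in> {min \<epsilon> 1..1} \<Longrightarrow> m \<le> \<Lambda> y"
      by (rule rate_bounded_below[of "min \<epsilon> 1"]) (use \<open>0 < \<epsilon>\<close> in auto)
    have "eventually (\<lambda>t. \<Lambda> (y t) < m) F" using order_tendstoD(2)[OF lim m(1)] .
    with y show ?thesis
    proof eventually_elim
      case (elim t)
      then have "y t \<notin> {min \<epsilon> 1..1}" using m(2)[of "y t"] by auto
      then show ?case using elim by auto
    qed
  qed
  then have "(y \<longlongrightarrow> 0) F" by (auto intro!: tendstoI)
  then show ?thesis using y by (auto simp: filterlim_at elim: eventually_mono)
qed

text \<open>The intermediate point is squeezed between two functions tending to 0, hence the slope
  there tends to \<open>\<nu>\<close>. This is what turns information on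
  \<open>\<Lambda>(y) / \<Lambda>(z)\<close> into information on \<open>y / z\<close>.\<close>

lemma ln_rate_diff_filter:
  assumes y: "filterlim y (at_right 0) F" and z: "filterlim z (at_right 0) F"
  obtains c where "(c \<longlongrightarrow> \<nu>) F"
    "eventually (\<lambda>t. ln (\<Lambda> (y t)) - ln (\<Lambda> (z t)) = c t * (ln (y t) - ln (z t))) F"
proof -
  define P where "P t \<xi> \<longleftrightarrow> min (y t) (z t) \<le> \<xi> \<and> \<xi> \<le> max (y t) (z t) \<and>
    ln (\<Lambda> (y t)) - ln (\<Lambda> (z t)) = (\<nu> + \<delta> \<xi>) * (ln (y t) - ln (z t))" for t \<xi>
  define \<xi> where "\<xi> t = (SOME x. P t x)" for t
  have small: "eventually (\<lambda>t. 0 < w t \<and> w t < 1) F" if "filterlim w (at_right 0) F" for w :: "'a \<Rightarrow> real"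
  proof -
    have "eventually (\<lambda>x::real. 0 < x \<and> x < 1) (at_right 0)"
      by (auto simp: eventually_at_right_field intro!: exI[of _ 1])
    from eventually_compose_filterlim[OF this that] show ?thesis .
  qed
  have ev: "eventually (\<lambda>t. P t (\<xi> t)) F"
    using small[OF y] small[OF z]
  proof eventually_elim
    case (elim t)
    then have "\<exists>x. P t x" unfolding P_def by (intro ln_rate_diff) auto
    then show ?case unfolding \<xi>_def by (rule someI_ex)
  qed
  have "(y \<longlongrightarrow> 0) F" "(z \<longlongrightarrow> 0) F" using y z by (auto simp: filterlim_at)
  then have "((\<lambda>t. min (y t) (z t)) \<longlongrightarrow> min 0 0) F" "((\<lambda>t. max (y t) (z t)) \<longlongrightarrow> max 0 0) F"
    by (blast intro: tendsto_min tendsto_max)+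
  then have "(\<xi> \<longlongrightarrow> 0) F"
    by (intro tendsto_sandwich[of "\<lambda>t. min (y t) (z t)" \<xi> F "\<lambda>t. max (y t) (z t)"])
       (use ev in \<open>auto simp: P_def elim: eventually_mono\<close>)
  moreover have "eventually (\<lambda>t. 0 < \<xi> t) F"
    using ev small[OF y] small[OF z] by eventually_elim (auto simp: P_def)
  ultimately have "filterlim \<xi> (at_right 0) F" by (auto simp: filterlim_at elim: eventually_mono)
  then have "((\<lambda>t. \<delta> (\<xi> t)) \<longlongrightarrow> 0) F" by (rule filterlim_compose[OF delta_lim])
  then have "((\<lambda>t. \<nu> + \<delta> (\<xi> t)) \<longlongrightarrow> \<nu>) F" using tendsto_add[OF tendsto_const] by fastforce
  then show ?thesis by (rule that) (use ev in \<open>auto simp: P_def elim: eventually_mono\<close>)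
qed

end

section \<open>The norming function and its scale\<close>

lemma slowly_varying_pos: "slowly_varying L \<Longrightarrow> 0 < x \<Longrightarrow> 0 < L x"
  by (simp add: slowly_varying_def)

locale norming = regular_rate +
  fixes L N :: "real \<Rightarrow> real"
  assumes nu_less_1: "\<nu> < 1"
    and L_pos: "\<And>x. 0 < x \<Longrightarrow> 0 < L x"
    and rate_eq: "\<And>y. y \<in> {0<..1} \<Longrightarrow> \<Lambda> y = y powr \<nu> * L (1 / y)"
    and N_sv: "slowly_varying N"
    and N_lim: "(norming_ratio \<nu> L N \<longlongrightarrow> 1) at_top"
begin

definition scale :: "real \<Rightarrow> real" where "scale t = N t / (\<nu> * t) powr (1 / \<nu>)"

lemma scale_pos: "0 < t \<Longrightarrow> 0 < scale t"
  using slowly_varying_pos[OF N_sv] nu_pos by (simp add: scale_def)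

text \<open>The argument of \<open>L\<close> in \<open>norming_ratio\<close> is exactly
  \<open>1 / scale t\<close>. The restriction to \<open>scale t \<le> 1\<close> is the range in
  which \<open>L\<close> is tied to \<open>\<Lambda>\<close>.\<close>

lemma rate_scale:
  assumes "0 < t" "scale t \<le> 1"
  shows "\<nu> * t * \<Lambda> (scale t) = norming_ratio \<nu> L N t"
proof -
  have "scale t powr \<nu> = N t powr \<nu> / (\<nu> * t)"
    using assms nu_pos slowly_varying_pos[OF N_sv assms(1)]
    by (simp add: scale_def powr_divide powr_powr)
  moreover have "1 / scale t = (\<nu> * t) powr (1 / \<nu>) / N t"
    by (simp add: scale_def)
  ultimately show ?thesis
    using rate_eq[of "scale t"] scale_pos[OF assms(1)] assms nu_pos by (simp add: norming_ratio_def)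
qed

text \<open>
  The values of \<open>L\<close> on \<open>(0,1)\<close> are unconstrained, so a scale above \<open>1\<close> must be excluded before
  \<open>norming_ratio\<close> says anything about \<open>\<Lambda>\<close>. Below \<open>1\<close> the scale is forced to be small, so it
  cannot cross \<open>1\<close> along \<open>t, 2t, 4t, \<dots>\<close>; and staying above \<open>1\<close> on such a sequence would make \<open>N\<close>
  grow like a positive power, faster than \<open>(3/2)^n\<close>.
\<close>

lemma scale_le_1: "eventually (\<lambda>t. scale t \<le> 1) at_top"
proof -
  \<comment> \<open>The growth factor of \<open>(\<nu> * t) powr (1 / \<nu>)\<close> when
    \<open>t\<close> doubles; it is at least 2 because \<open>\<nu> < 1\<close>.\<close>
  define q where "q = 2 powr (1 / \<nu>)"
  have q: "2 \<le> q"
    using nu_pos nu_less_1 powr_mono[of 1 "1 / \<nu>" 2] by (simp add: q_def)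
  \<comment> \<open>The left end is where \<open>q * scale t\<close> equals 1/2: a scale violating
    \<open>small\<close> below lies in this interval.\<close>
  obtain m where m: "0 < m" "\<And>y. y \<in> {1/(2*q)..1} \<Longrightarrow> m \<le> \<Lambda> y"
    using rate_bounded_below[of "1/(2*q)"] q by auto
  have double: "((\<lambda>t. N (2 * t) / N t) \<longlongrightarrow> 1) at_top"
    using N_sv by (simp add: slowly_varying_def)
  have tinv: "((\<lambda>t. 2 / (\<nu> * t)) \<longlongrightarrow> 0) at_top"
    using nu_pos by (intro tendsto_divide_0[OF tendsto_const] filterlim_at_top_imp_at_infinity
      filterlim_tendsto_pos_mult_at_top[OF tendsto_const] filterlim_ident)
  have "eventually (\<lambda>t. 0 < t \<and> norming_ratio \<nu> L N t < 2 \<and> 2 / (\<nu> * t) < m \<and>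
      1/2 < N (2 * t) / N t \<and> N (2 * t) / N t < 3/2) at_top"
    using eventually_gt_at_top[of 0] order_tendstoD(2)[OF N_lim, of 2] order_tendstoD(2)[OF tinv m(1)]
      order_tendstoD(1)[OF double, of "1/2"] order_tendstoD(2)[OF double, of "3/2"]
    by (intro eventually_conj) auto
  then obtain T where T: "\<And>t. T \<le> t \<Longrightarrow> 0 < t \<and> norming_ratio \<nu> L N t < 2 \<and> 2 / (\<nu> * t) < m \<and>
      1/2 < N (2 * t) / N t \<and> N (2 * t) / N t < 3/2"
    unfolding eventually_at_top_linorder by blast
  have small: "q * scale t < 1/2" if "T \<le> t" "scale t \<le> 1" for t
  proof (rule ccontr)
    assume "\<not> ?thesis"
    then have "m \<le> \<Lambda> (scale t)" using m(2)[of "scale t"] that q by (auto simp: field_simps)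
    moreover have "\<nu> * t * \<Lambda> (scale t) < 2" using rate_scale[of t] T[OF that(1)] that by simp
    then have "\<Lambda> (scale t) < 2 / (\<nu> * t)" using T[OF that(1)] nu_pos by (simp add: field_simps)
    ultimately show False using T[OF that(1)] by linarith
  qed
  have N_scale: "N t = scale t * (\<nu> * t) powr (1 / \<nu>)" if "0 < t" for t
    using that nu_pos by (simp add: scale_def)
  have N2: "N (2 * t) = scale (2 * t) * (2 powr (1 / \<nu>) * (\<nu> * t) powr (1 / \<nu>))" if "0 < t" for t
    using N_scale[of "2 * t"] that nu_pos by (simp add: powr_mult mult_ac)
  \<comment> \<open>Here \<open>N (2 * t) / N t = q * scale (2 * t) / scale t\<close>. The bound 3/2
    and \<open>q \<ge> 2\<close> give the factor 3/4. The bound 1/2 gives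
    \<open>q * scale (2 * t) > 1/2\<close>, which \<open>small\<close> forbids if
    \<open>scale (2 * t) \<le> 1\<close>.\<close>
  have step: "1 < scale (2 * t) \<and> 4 * scale (2 * t) < 3 * scale t" if "T \<le> t" "1 < scale t" for t
  proof -
    have t: "0 < t" using T[OF that(1)] by simp
    have pos: "0 < N t" using slowly_varying_pos[OF N_sv t] .
    define p where "p = (\<nu> * t) powr (1 / \<nu>)"
    have p: "0 < p" using t nu_pos by (simp add: p_def)
    have ratio: "N (2 * t) / N t = q * scale (2 * t) / scale t"
      using N2[OF t] N_scale[OF t] p by (simp add: p_def q_def)
    have s2: "0 < scale (2 * t)" using scale_pos t by simp
    have bounds: "1/2 < q * scale (2 * t) / scale t" "q * scale (2 * t) / scale t < 3/2"
      using T[OF that(1)] unfolding ratio by auto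
    have "q * scale (2 * t) < 3/2 * scale t" using bounds(2) that(2) by (simp add: field_simps)
    moreover have "2 * scale (2 * t) \<le> q * scale (2 * t)" using q s2 by simp
    ultimately have up: "4 * scale (2 * t) < 3 * scale t" by linarith
    have "1 < scale (2 * t)"
    proof (rule ccontr)
      assume "\<not> ?thesis"
      then have le: "scale (2 * t) \<le> 1" by simp
      have "1/2 * scale t < q * scale (2 * t)" using bounds(1) that(2) by (simp add: field_simps)
      moreover have "q * scale (2 * t) < 1/2" using small[of "2 * t"] le that(1) t by simp
      ultimately show False using that(2) by simp
    qed
    with up show ?thesis by simp
  qed
  have "scale t \<le> 1" if "T \<le> t" for t
  proof (rule ccontr)
    assume "\<not> ?thesis"
    then have bad: "1 < scale t" by simp
    have t: "0 < t" using T[OF that] by simp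
    have *: "T \<le> 2 ^ n * t \<and> 1 < scale (2 ^ n * t) \<and> scale (2 ^ n * t) \<le> (3/4) ^ n * scale t" for n
    proof (induction n)
      case (Suc n)
      have "0 < 2 ^ n * t" using t by simp
      then have "T \<le> 2 * (2 ^ n * t)" using Suc by linarith
      then show ?case using step[of "2 ^ n * t"] Suc by (simp add: mult.assoc)
    qed (use that bad in auto)
    obtain n where "(3/4) ^ n < 1 / scale t"
      using real_arch_pow_inv[of "1 / scale t" "3/4"] bad by auto
    then have "(3/4) ^ n * scale t < 1" using bad by (simp add: field_simps)
    then show False using *[of n] by linarith
  qed
  then show ?thesis using eventually_at_top_linorder by blast
qed

lemma scale_at_right_0: "filterlim scale (at_right 0) at_top"
proof (rule filterlim_at_right_0_of_rate)
  show "eventually (\<lambda>t. scale t \<in> {0<..1}) at_top"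
    using scale_le_1 eventually_gt_at_top[of 0] by eventually_elim (auto simp: scale_pos)
  have "((\<lambda>t. 1 / (\<nu> * t)) \<longlongrightarrow> 0) at_top" using nu_pos by real_asymp
  from tendsto_mult[OF N_lim this]
  have "((\<lambda>t. norming_ratio \<nu> L N t * (1 / (\<nu> * t))) \<longlongrightarrow> 0) at_top" by simp
  then show "((\<lambda>t. \<Lambda> (scale t)) \<longlongrightarrow> 0) at_top"
  proof (rule Lim_transform_eventually)
    show "eventually (\<lambda>t. norming_ratio \<nu> L N t * (1 / (\<nu> * t)) = \<Lambda> (scale t)) at_top"
      using scale_le_1 eventually_gt_at_top[of 0]
    proof eventually_elim
      case (elim t)
      then show ?case using rate_scale[of t] nu_pos by (simp add: field_simps)
    qed
  qed
qed

end

section \<open>Solutions of the decay equation\<close>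

locale rate_decay = regular_rate +
  fixes R :: "real \<Rightarrow> real"
  assumes R_range: "\<And>t. 0 < t \<Longrightarrow> R t \<in> {0<..1}"
    and R_deriv: "\<And>t. 0 < t \<Longrightarrow> DERIV R t :> - (R t * \<Lambda> (R t))"
    and R_lim: "(R \<longlongrightarrow> 0) at_top"
begin

lemma R_at_right_0: "filterlim R (at_right 0) at_top"
  unfolding filterlim_at using R_lim eventually_mono[OF eventually_gt_at_top[of 0]] R_range
  by (fastforce intro: eventually_mono[OF eventually_gt_at_top[of 0]])

text \<open>Asserted only eventually: the two-sided derivative of \<open>\<Lambda>\<close> is
  available below 1, and \<open>R t < 1\<close> is guaranteed only for large
  \<open>t\<close>.\<close>

lemma DERIV_inverse_rate:
  "eventually (\<lambda>t. DERIV (\<lambda>t. 1 / \<Lambda> (R t)) t :> \<nu> + \<delta> (R t)) at_top"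
  using eventually_gt_at_top[of 0] order_tendstoD(2)[OF R_lim zero_less_one]
proof eventually_elim
  case (elim t)
  have r: "0 < R t" "R t < 1" using R_range elim by auto
  have p: "0 < \<Lambda> (R t)" using rate_pos r by auto
  have "DERIV (\<lambda>t. \<Lambda> (R t)) t :> \<Lambda>' (R t) * - (R t * \<Lambda> (R t))"
    by (rule DERIV_chain2[where f = \<Lambda> and g = R, OF rate_deriv_at[OF r] R_deriv[OF elim(1)]])
  from DERIV_divide[OF DERIV_const[of 1] this]
  have "DERIV (\<lambda>t. 1 / \<Lambda> (R t)) t :> - (\<Lambda>' (R t) * - (R t * \<Lambda> (R t))) / (\<Lambda> (R t) * \<Lambda> (R t))"
    using p by simp
  then show ?case using p r rate_deriv_eq[of "R t"] by simp
qed

lemma inverse_rate_asymp: "((\<lambda>t. (1 / \<Lambda> (R t)) / t) \<longlongrightarrow> \<nu>) at_top"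
proof (rule lhospital_at_top_at_top[OF filterlim_ident _ DERIV_inverse_rate])
  have "((\<lambda>t. \<delta> (R t)) \<longlongrightarrow> 0) at_top" by (rule filterlim_compose[OF delta_lim R_at_right_0])
  from tendsto_add[OF tendsto_const[of \<nu>] this]
  show "((\<lambda>t. (\<nu> + \<delta> (R t)) / 1) \<longlongrightarrow> \<nu>) at_top" by simp
qed auto

lemma time_rate: "((\<lambda>t. \<nu> * t * \<Lambda> (R t)) \<longlongrightarrow> 1) at_top"
proof -
  have "((\<lambda>t. \<nu> / ((1 / \<Lambda> (R t)) / t)) \<longlongrightarrow> \<nu> / \<nu>) at_top"
    using nu_pos by (intro tendsto_divide inverse_rate_asymp tendsto_const) auto
  then show ?thesis using nu_pos by (simp add: mult_ac)
qed

text \<open>L'Hospital against \<open>ln t\<close>: the correction has derivative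
  \<open>\<delta>(R) = \<Lambda>(R)\<close>, which \<open>time_rate\<close> compares with
  \<open>1 / (\<nu> t)\<close>.\<close>

lemma inverse_rate_second_order:
  assumes "\<And>y. y \<in> {0<..1} \<Longrightarrow> \<delta> y = \<Lambda> y"
  shows "((\<lambda>t. (1 / \<Lambda> (R t) - \<nu> * t) / ln t) \<longlongrightarrow> 1 / \<nu>) at_top"
proof (rule lhospital_at_top_at_top[OF ln_at_top])
  show "eventually (\<lambda>t. DERIV (\<lambda>t. 1 / \<Lambda> (R t) - \<nu> * t) t :> \<Lambda> (R t)) at_top"
    using DERIV_inverse_rate eventually_gt_at_top[of 0]
  proof eventually_elim
    case (elim t)
    have "DERIV (\<lambda>t. 1 / \<Lambda> (R t) - \<nu> * t) t :> (\<nu> + \<delta> (R t)) - \<nu>"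
      by (rule DERIV_diff[OF elim(1)]) (auto intro!: derivative_eq_intros)
    then show ?case using assms R_range elim by simp
  qed
  show "eventually (\<lambda>t::real. DERIV ln t :> 1 / t) at_top"
    using eventually_gt_at_top[of "0::real"] by eventually_elim (auto intro!: derivative_eq_intros)
  show "eventually (\<lambda>t::real. 1 / t \<noteq> 0) at_top"
    using eventually_gt_at_top[of "0::real"] by eventually_elim auto
  have "((\<lambda>t. (\<nu> * t * \<Lambda> (R t)) / \<nu>) \<longlongrightarrow> 1 / \<nu>) at_top"
    using nu_pos by (intro tendsto_divide time_rate tendsto_const) auto
  then show "((\<lambda>t. \<Lambda> (R t) / (1 / t)) \<longlongrightarrow> 1 / \<nu>) at_top" using nu_pos by (simp add: mult_ac)
qed

end

section \<open>Comparison of the solution with the scale\<close>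

locale normed_decay = norming \<nu> \<Lambda> \<Lambda>' \<delta> L N + rate_decay \<nu> \<Lambda> \<Lambda>' \<delta> R
  for \<nu> \<Lambda> \<Lambda>' \<delta> L N R
begin

text \<open>The relative error when \<open>R \<Lambda>(R)\<close>, that is \<open>- R'\<close>, is
  replaced by \<open>scale t / (\<nu> t)\<close>: one factor compares \<open>R\<close> with the
  scale, the other \<open>\<Lambda>(R)\<close> with \<open>1 / (\<nu> t)\<close>.\<close>

definition remainder :: "real \<Rightarrow> real"
  where "remainder t = R t / scale t * (\<nu> * t * \<Lambda> (R t)) - 1"

text \<open>Dividing the difference of the logarithms of \<open>\<Lambda>(R)\<close> and
  \<open>\<Lambda>(scale)\<close> by the slope \<open>c\<close> recovers
  \<open>ln (R / scale)\<close>. The factor \<open>\<nu> t\<close> cancels in that difference, so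
  the norming ratio can stand in for \<open>\<Lambda>(scale)\<close>.\<close>

lemma remainder_exp:
  obtains c where "(c \<longlongrightarrow> \<nu>) at_top"
    "eventually (\<lambda>t. remainder t = exp (ln (\<nu> * t * \<Lambda> (R t)) +
       (ln (\<nu> * t * \<Lambda> (R t)) - ln (norming_ratio \<nu> L N t)) / c t) - 1) at_top"
proof -
  obtain c where c: "(c \<longlongrightarrow> \<nu>) at_top"
    "eventually (\<lambda>t. ln (\<Lambda> (R t)) - ln (\<Lambda> (scale t)) = c t * (ln (R t) - ln (scale t))) at_top"
    using ln_rate_diff_filter[OF R_at_right_0 scale_at_right_0] .
  have "eventually (\<lambda>t. remainder t = exp (ln (\<nu> * t * \<Lambda> (R t)) +
       (ln (\<nu> * t * \<Lambda> (R t)) - ln (norming_ratio \<nu> L N t)) / c t) - 1) at_top"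
    using c(2) order_tendstoD(1)[OF c(1) nu_pos] eventually_gt_at_top[of 0] scale_le_1
  proof eventually_elim
    case (elim t)
    have pos: "0 < R t" "0 < \<Lambda> (R t)" "0 < scale t" "0 < \<Lambda> (scale t)" "0 < \<nu> * t"
      using R_range[of t] rate_pos[of "R t"] rate_pos[of "scale t"] scale_pos[of t] elim nu_pos by auto
    have n: "norming_ratio \<nu> L N t = \<nu> * t * \<Lambda> (scale t)" using rate_scale elim by simp
    have "ln (\<nu> * t * \<Lambda> (R t)) - ln (norming_ratio \<nu> L N t) = c t * (ln (R t) - ln (scale t))"
      unfolding n ln_mult_pos[OF pos(5) pos(2)] ln_mult_pos[OF pos(5) pos(4)] using elim(1) by simp
    then have "(ln (\<nu> * t * \<Lambda> (R t)) - ln (norming_ratio \<nu> L N t)) / c t = ln (R t / scale t)"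
      using elim(2) pos by (simp add: ln_divide_pos)
    then show ?case using pos by (simp add: remainder_def exp_add)
  qed
  with c(1) show ?thesis by (rule that)
qed

lemma remainder_tendsto_0: "(remainder \<longlongrightarrow> 0) at_top"
proof -
  obtain c where c: "(c \<longlongrightarrow> \<nu>) at_top"
    "eventually (\<lambda>t. remainder t = exp (ln (\<nu> * t * \<Lambda> (R t)) +
       (ln (\<nu> * t * \<Lambda> (R t)) - ln (norming_ratio \<nu> L N t)) / c t) - 1) at_top"
    using remainder_exp .
  have lim: "((\<lambda>t. exp (ln (\<nu> * t * \<Lambda> (R t)) +
       (ln (\<nu> * t * \<Lambda> (R t)) - ln (norming_ratio \<nu> L N t)) / c t) - 1) \<longlongrightarrow>
       exp (ln 1 + (ln 1 - ln 1) / \<nu>) - 1) at_top"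
    using nu_pos by (intro tendsto_intros time_rate N_lim c(1)) auto
  have "(remainder \<longlongrightarrow> exp (ln 1 + (ln 1 - ln 1) / \<nu>) - 1) at_top"
    by (rule Lim_transform_eventually[OF lim]) (use c(2) in \<open>auto elim: eventually_mono\<close>)
  then show ?thesis by simp
qed

text \<open>The exponent of \<open>remainder_exp\<close> is expanded in units of
  \<open>ln t / t\<close>: the assumption on \<open>norming_ratio\<close> makes its logarithm
  negligible, and \<open>ln (b \<nu> t + 1)\<close> is asymptotic to \<open>ln t\<close>.\<close>

lemma remainder_second_order:
  assumes delta_rate: "\<And>y. y \<in> {0<..1} \<Longrightarrow> \<delta> y = \<Lambda> y"
    and N_small: "(\<lambda>t. norming_ratio \<nu> L N t - 1) \<in> o(\<lambda>t. ln t / t)"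
    and b: "0 < b"
  shows "(\<lambda>t. remainder t - (- ((1 + \<nu>) / \<nu> ^ 3) * (ln (b * \<nu> * t + 1) / t))) \<in> o(\<lambda>t. ln t / t)"
proof -
  obtain c where c: "(c \<longlongrightarrow> \<nu>) at_top"
    "eventually (\<lambda>t. remainder t = exp (ln (\<nu> * t * \<Lambda> (R t)) +
       (ln (\<nu> * t * \<Lambda> (R t)) - ln (norming_ratio \<nu> L N t)) / c t) - 1) at_top"
    using remainder_exp .
  define A where "A t = \<nu> * t * \<Lambda> (R t)" for t
  define n where "n t = norming_ratio \<nu> L N t" for t
  define l where "l t = ln t / t" for t :: real
  define e where "e t = ln (A t) + (ln (A t) - ln (n t)) / c t" for t
  have ev: "eventually (\<lambda>t::real. 1 < t) at_top" by (rule eventually_gt_at_top)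
  have A: "(A \<longlongrightarrow> 1) at_top" using time_rate unfolding A_def .
  have n: "(n \<longlongrightarrow> 1) at_top" using N_lim by (simp add: n_def[abs_def])
  have lnA: "((\<lambda>t. ln (A t) / l t) \<longlongrightarrow> - (1 / \<nu>\<^sup>2)) at_top"
  proof -
    have "((\<lambda>t. 1 / A t) \<longlongrightarrow> 1 / 1) at_top" by (intro tendsto_intros A) auto
    then have inv: "((\<lambda>t. 1 / A t) \<longlongrightarrow> 1) at_top" by simp
    obtain h where h: "\<And>t. ln (1 / A t) - ln 1 = h t * (1 / A t - 1)" "(h \<longlongrightarrow> 1) at_top"
      using difference_quotient_tendsto[OF DERIV_ln[OF zero_less_one] inv] by auto
    \<comment> \<open>With \<open>1 / A t - 1 = (1 / \<Lambda>(R) - \<nu> t) / (\<nu> t)\<close>,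
      division by \<open>l t\<close> leaves the second-order limit \<open>1 / \<nu>\<close>, divided
      once more by \<open>\<nu>\<close>.\<close>
    have "((\<lambda>t. - (h t * (((1 / \<Lambda> (R t) - \<nu> * t) / ln t) / \<nu>))) \<longlongrightarrow> - (1 * (1 / \<nu> / \<nu>))) at_top"
      using nu_pos by (intro tendsto_minus tendsto_mult h(2) tendsto_divide[OF _ tendsto_const]
        inverse_rate_second_order[OF delta_rate]) auto
    then have lim: "((\<lambda>t. - (h t * (((1 / \<Lambda> (R t) - \<nu> * t) / ln t) / \<nu>))) \<longlongrightarrow> - (1 / \<nu>\<^sup>2)) at_top"
      by (simp add: power2_eq_square)
    show ?thesis
    proof (rule Lim_transform_eventually[OF lim])
      show "eventually (\<lambda>t. - (h t * (((1 / \<Lambda> (R t) - \<nu> * t) / ln t) / \<nu>)) = ln (A t) / l t) at_top"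
        using ev
      proof eventually_elim
        case (elim t)
        have p: "0 < \<Lambda> (R t)" "0 < ln t" using R_range[of t] rate_pos[of "R t"] elim by auto
        have "0 < A t" using p elim nu_pos by (simp add: A_def)
        then have lnA: "ln (A t) = - (h t * (1 / A t - 1))" using h(1)[of t] by (simp add: ln_divide_pos)
        show ?case unfolding lnA using p elim nu_pos by (simp add: A_def l_def field_simps)
      qed
    qed
  qed
  have lnn: "((\<lambda>t. ln (n t) / l t) \<longlongrightarrow> 0) at_top"
  proof -
    obtain h where h: "\<And>t. ln (n t) - ln 1 = h t * (n t - 1)" "(h \<longlongrightarrow> 1) at_top"
      using difference_quotient_tendsto[OF DERIV_ln[OF zero_less_one] n] by auto
    have "((\<lambda>t. h t * ((n t - 1) / l t)) \<longlongrightarrow> 1 * 0) at_top"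
      using smalloD_tendsto[OF N_small] by (intro tendsto_mult h(2)) (simp add: n_def l_def)
    then show ?thesis using h(1) by simp
  qed
  have el: "((\<lambda>t. e t / l t) \<longlongrightarrow> - ((1 + \<nu>) / \<nu> ^ 3)) at_top"
  proof -
    have "((\<lambda>t. ln (A t) / l t + (ln (A t) / l t - ln (n t) / l t) / c t) \<longlongrightarrow>
        - (1 / \<nu>\<^sup>2) + (- (1 / \<nu>\<^sup>2) - 0) / \<nu>) at_top"
      using nu_pos by (intro tendsto_intros lnA lnn c(1)) auto
    moreover have "- (1 / \<nu>\<^sup>2) + (- (1 / \<nu>\<^sup>2) - 0) / \<nu> = - ((1 + \<nu>) / \<nu> ^ 3)"
      using nu_pos by (simp add: field_simps power2_eq_square power3_eq_cube)
    ultimately show ?thesis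
      by (simp add: e_def add_divide_distrib diff_divide_distrib mult.commute)
  qed
  have e0: "(e \<longlongrightarrow> 0) at_top"
  proof -
    have "((\<lambda>t. ln (A t) + (ln (A t) - ln (n t)) / c t) \<longlongrightarrow> ln 1 + (ln 1 - ln 1) / \<nu>) at_top"
      using nu_pos by (intro tendsto_intros A n c(1)) auto
    then show ?thesis by (simp add: e_def[abs_def])
  qed
  obtain h where h: "\<And>t. exp (e t) - exp 0 = h t * (e t - 0)" "(h \<longlongrightarrow> exp 0) at_top"
    using difference_quotient_tendsto[OF DERIV_exp e0] by auto
  have r: "((\<lambda>t. remainder t / l t) \<longlongrightarrow> - ((1 + \<nu>) / \<nu> ^ 3)) at_top"
  proof (rule Lim_transform_eventually)
    show "((\<lambda>t. h t * (e t / l t)) \<longlongrightarrow> - ((1 + \<nu>) / \<nu> ^ 3)) at_top"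
      using tendsto_mult[OF h(2) el] by simp
    show "eventually (\<lambda>t. h t * (e t / l t) = remainder t / l t) at_top"
      using c(2)
    proof eventually_elim
      case (elim t)
      then have "remainder t = exp (e t) - 1" by (simp add: e_def A_def n_def)
      then show ?case using h(1)[of t] by simp
    qed
  qed
  have lg: "((\<lambda>t. ln (b * \<nu> * t + 1) / ln t) \<longlongrightarrow> 1) at_top"
  proof -
    have "0 < b * \<nu>" using b nu_pos by simp
    then show ?thesis by real_asymp
  qed
  have lim: "((\<lambda>t. remainder t / l t + (1 + \<nu>) / \<nu> ^ 3 * (ln (b * \<nu> * t + 1) / ln t)) \<longlongrightarrow> 0) at_top"
    using tendsto_add[OF r tendsto_mult[OF tendsto_const[of "(1 + \<nu>) / \<nu> ^ 3"] lg]] by simp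
  show ?thesis
  proof (rule smalloI_tendsto)
    show "((\<lambda>t. (remainder t - (- ((1 + \<nu>) / \<nu> ^ 3) * (ln (b * \<nu> * t + 1) / t))) / (ln t / t)) \<longlongrightarrow> 0) at_top"
    proof (rule Lim_transform_eventually[OF lim])
      show "eventually (\<lambda>t. remainder t / l t + (1 + \<nu>) / \<nu> ^ 3 * (ln (b * \<nu> * t + 1) / ln t) =
        (remainder t - (- ((1 + \<nu>) / \<nu> ^ 3) * (ln (b * \<nu> * t + 1) / t))) / (ln t / t)) at_top"
        using ev
      proof eventually_elim
        case (elim t)
        then have "0 < ln t" by simp
        with elim nu_pos show ?case by (simp add: l_def field_simps)
      qed
    qed
    show "eventually (\<lambda>t::real. ln t / t \<noteq> 0) at_top" using ev by eventually_elim auto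
  qed
qed

end

section \<open>The case in which the slope correction equals the rate\<close>

context regular_rate
begin

text \<open>
  If \<open>\<delta> = \<Lambda>\<close>, the differential equation for \<open>\<Lambda>\<close> integrates to \<open>\<Lambda> y = \<nu> y\<^sup>\<nu> / (K - y\<^sup>\<nu>)\<close>, so the
  norming function can be taken constant.
\<close>

lemma rate_explicit:
  assumes delta_rate: "\<And>y. y \<in> {0<..1} \<Longrightarrow> \<delta> y = \<Lambda> y"
  obtains K where "0 < K" "\<And>y. y \<in> {0<..<1} \<Longrightarrow> y powr \<nu> * (1 + \<nu> / \<Lambda> y) = K"
proof -
  define k where "k y = y powr \<nu> * (1 + \<nu> / \<Lambda> y)" for y
  have "\<exists>K. \<forall>y\<in>{0<..<1::real}. k y = K"
  proof (rule has_field_derivative_zero_constant)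
    fix y :: real assume "y \<in> {0<..<1}"
    then have y: "0 < y" "y < 1" by auto
    have p: "0 < \<Lambda> y" using rate_pos y by auto
    have "DERIV (\<lambda>y. 1 + \<nu> / \<Lambda> y) y :> - (\<nu> * \<Lambda>' y) / (\<Lambda> y * \<Lambda> y)"
      using rate_deriv_at[OF y] p by (auto intro!: derivative_eq_intros)
    from DERIV_mult[OF has_real_derivative_powr[OF y(1), of \<nu>] this]
    have D: "DERIV k y :> \<nu> * y powr (\<nu> - 1) * (1 + \<nu> / \<Lambda> y) + - (\<nu> * \<Lambda>' y) / (\<Lambda> y * \<Lambda> y) * y powr \<nu>"
      by (simp add: k_def[abs_def])
    have "\<Lambda>' y = (\<nu> + \<Lambda> y) * \<Lambda> y / y" using rate_deriv_eq[of y] delta_rate[of y] y by simp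
    moreover have "y powr \<nu> = y powr (\<nu> - 1) * y" using y by (simp add: powr_diff)
    ultimately have "\<nu> * y powr (\<nu> - 1) * (1 + \<nu> / \<Lambda> y) + - (\<nu> * \<Lambda>' y) / (\<Lambda> y * \<Lambda> y) * y powr \<nu> = 0"
      using p y by (simp only:) (simp add: field_simps)
    then show "(k has_real_derivative 0) (at y within {0<..<1})"
      using D by (simp add: has_field_derivative_at_within)
  qed simp
  then obtain K where K: "\<And>y. y \<in> {0<..<1} \<Longrightarrow> k y = K" by blast
  moreover have "0 < k (1/2)" using rate_pos[of "1/2"] nu_pos by (auto simp: k_def add_pos_pos)
  ultimately show ?thesis using K[of "1/2"] by (intro that[of K]) (auto simp: k_def)
qed

text \<open>By the explicit form, \<open>L\<close> tends to \<open>\<nu> / K\<close> at infinity,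
  which dictates \<open>C powr \<nu> = K / \<nu>\<close>. The norming ratio is then eventually
  \<open>\<nu>^2 t / (\<nu>^2 t - 1)\<close>, which differs from 1 by order \<open>1 / t\<close>
  only.\<close>

lemma constant_norming:
  assumes rate_eq: "\<And>y. y \<in> {0<..1} \<Longrightarrow> \<Lambda> y = y powr \<nu> * L (1 / y)"
    and delta_rate: "\<And>y. y \<in> {0<..1} \<Longrightarrow> \<delta> y = \<Lambda> y"
  obtains C where "0 < C" "(\<lambda>t. norming_ratio \<nu> L (\<lambda>_. C) t - 1) \<in> o(\<lambda>t. ln t / t)"
proof -
  obtain K where K: "0 < K" "\<And>y. y \<in> {0<..<1} \<Longrightarrow> y powr \<nu> * (1 + \<nu> / \<Lambda> y) = K"
    using rate_explicit[OF delta_rate] by blast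
  define C where "C = (K / \<nu>) powr (1 / \<nu>)"
  have C: "0 < C" "C powr \<nu> = K / \<nu>" using K(1) nu_pos by (auto simp: C_def powr_powr)
  define y where "y t = C / (\<nu> * t) powr (1 / \<nu>)" for t
  have "(y \<longlongrightarrow> 0) at_top" using nu_pos C(1) unfolding y_def by real_asymp
  then have "eventually (\<lambda>t. y t < 1) at_top" by (rule order_tendstoD) simp
  then have ev: "eventually (\<lambda>t. 1 / (1 - 1 / (\<nu>\<^sup>2 * t)) - 1 = norming_ratio \<nu> L (\<lambda>_. C) t - 1) at_top"
    using eventually_gt_at_top[of "1 / \<nu>\<^sup>2"]
  proof eventually_elim
    case (elim t)
    have "0 < 1 / \<nu>\<^sup>2" using nu_pos by simp
    then have t: "0 < t" using elim by linarith
    have gt: "1 < \<nu>\<^sup>2 * t" using elim nu_pos by (simp add: field_simps)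
    have y: "0 < y t" "y t \<in> {0<..<1}" using C t nu_pos elim by (auto simp: y_def)
    have p: "0 < \<Lambda> (y t)" using rate_pos y by auto
    have py: "y t powr \<nu> = K / \<nu> / (\<nu> * t)"
      using C t nu_pos by (simp add: y_def powr_divide powr_powr)
    have "K / \<nu> / (\<nu> * t) * (1 + \<nu> / \<Lambda> (y t)) = K" using K(2)[OF y(2)] py by simp
    then have "K * (1 + \<nu> / \<Lambda> (y t)) = K * (\<nu>\<^sup>2 * t)"
      using nu_pos t by (simp add: field_simps power2_eq_square)
    then have "1 + \<nu> / \<Lambda> (y t) = \<nu>\<^sup>2 * t" using K(1) by simp
    then have "\<Lambda> (y t) * (\<nu>\<^sup>2 * t - 1) = \<nu>" using p by (simp add: field_simps)
    then have "\<nu> * t * \<Lambda> (y t) = \<nu>\<^sup>2 * t / (\<nu>\<^sup>2 * t - 1)"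
      using gt by (simp add: field_simps power2_eq_square)
    moreover have "norming_ratio \<nu> L (\<lambda>_. C) t = \<nu> * t * \<Lambda> (y t)"
      using rate_eq[of "y t"] y py C t nu_pos by (simp add: norming_ratio_def y_def)
    ultimately show ?case using gt t nu_pos by (simp add: field_simps)
  qed
  have "(\<lambda>t. 1 / (1 - 1 / (\<nu>\<^sup>2 * t)) - 1) \<in> o(\<lambda>t. ln t / t)"
    using nu_pos by real_asymp
  then have "(\<lambda>t. norming_ratio \<nu> L (\<lambda>_. C) t - 1) \<in> o(\<lambda>t. ln t / t)"
    by (subst (asm) landau_o.small.in_cong[OF ev])
  with C(1) show ?thesis by (rule that)
qed

end

subsection \<open>Power series and discrete chains\<close>

text \<open>Tonelli for double series, passed through unordered sums and stated for
  \<open>sums\<close>. It serves both the semigroup law and the invariance of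
  \<open>\<pi>\<close>.\<close>

lemma sums_swap_nonneg:
  fixes a :: "nat \<Rightarrow> nat \<Rightarrow> real"
  assumes nonneg: "\<And>k j. 0 \<le> a k j" and rows: "\<And>k. (\<lambda>j. a k j) sums b k" and total: "b sums c"
  shows "summable (\<lambda>k. a k j)" "(\<lambda>j. \<Sum>k. a k j) sums c"
proof -
  have b_nonneg: "0 \<le> b k" for k
    using rows[of k] nonneg by (metis sums_unique suminf_nonneg sums_summable)
  have total': "(b has_sum c) UNIV" using sums_nonneg_imp_has_sum[OF total] b_nonneg by blast
  have rows': "((\<lambda>j. a k j) has_sum b k) UNIV" for k
    using sums_nonneg_imp_has_sum[OF rows] nonneg by blast
  have "(\<lambda>(k, j). a k j) summable_on (UNIV \<times> UNIV)"
    by (rule summable_on_SigmaI[where g = b])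
       (use rows' total' nonneg in \<open>auto simp: summable_on_def\<close>)
  then have "((\<lambda>(k, j). a k j) has_sum c) (UNIV \<times> UNIV)"
    by (intro has_sum_SigmaI[where g = b]) (use rows' total' in auto)
  then have swapped: "((\<lambda>(j, k). a k j) has_sum c) (UNIV \<times> UNIV)"
    by (subst has_sum_swap) auto
  have cols: "(\<lambda>k. a k j) summable_on UNIV" for j
    using summable_on_SigmaD1[of "\<lambda>j k. a k j" UNIV "\<lambda>_. UNIV" j] swapped
    by (auto simp: summable_on_def)
  then have col_sums: "(\<lambda>k. a k j) sums infsum (\<lambda>k. a k j) UNIV" for j
    by (intro has_sum_imp_sums has_sum_infsum)
  then show "summable (\<lambda>k. a k j)" by (rule sums_summable)
  have "((\<lambda>j. infsum (\<lambda>k. a k j) UNIV) has_sum c) UNIV"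
    by (rule has_sum_SigmaD[OF swapped]) (use cols in \<open>auto intro: has_sum_infsum\<close>)
  from has_sum_imp_sums[OF this] show "(\<lambda>j. \<Sum>k. a k j) sums c"
    using sums_unique[OF col_sums] by simp
qed

lemma fps_mult_sums:
  fixes P Q :: "real fps"
  assumes P: "(\<lambda>j. fps_nth P j * x ^ j) sums p" "summable (\<lambda>j. \<bar>fps_nth P j * x ^ j\<bar>)"
    and Q: "(\<lambda>j. fps_nth Q j * x ^ j) sums q" "summable (\<lambda>j. \<bar>fps_nth Q j * x ^ j\<bar>)"
  shows "(\<lambda>j. fps_nth (P * Q) j * x ^ j) sums (p * q)"
proof -
  have "(\<lambda>k. \<Sum>i\<le>k. fps_nth P i * x ^ i * (fps_nth Q (k - i) * x ^ (k - i))) sums (p * q)"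
    using Cauchy_product_sums[of "\<lambda>j. fps_nth P j * x ^ j" "\<lambda>j. fps_nth Q j * x ^ j"] P Q
    by (simp add: sums_iff)
  moreover have "(\<Sum>i\<le>k. fps_nth P i * x ^ i * (fps_nth Q (k - i) * x ^ (k - i))) =
      fps_nth (P * Q) k * x ^ k" for k
    unfolding fps_mult_nth sum_distrib_right atMost_atLeast0
    by (intro sum.cong refl) (auto simp: power_add[symmetric] mult_ac)
  ultimately show ?thesis by simp
qed

lemma fps_power_nonneg:
  fixes P :: "real fps"
  assumes "\<And>j. 0 \<le> fps_nth P j"
  shows "0 \<le> fps_nth (P ^ k) j"
proof (induction k arbitrary: j)
  case (Suc k)
  then show ?case using assms by (auto simp: fps_mult_nth intro!: sum_nonneg)
qed auto

lemma fps_power_sums: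
  fixes P :: "real fps"
  assumes nonneg: "\<And>j. 0 \<le> fps_nth P j" and x: "0 \<le> x" and sums: "(\<lambda>j. fps_nth P j * x ^ j) sums s"
  shows "(\<lambda>j. fps_nth (P ^ k) j * x ^ j) sums s ^ k"
proof (induction k)
  case 0
  have "(\<lambda>j. if j = 0 then (1::real) else 0) sums 1" by (rule sums_single)
  moreover have eq: "(\<lambda>j. fps_nth (P ^ 0) j * x ^ j) = (\<lambda>j. if j = 0 then 1 else 0)" by auto
  ultimately show ?case unfolding eq by simp
next
  case (Suc k)
  have "(\<lambda>j. fps_nth (P * P ^ k) j * x ^ j) sums (s * s ^ k)"
    using sums Suc nonneg fps_power_nonneg[OF nonneg, of k] x
    by (intro fps_mult_sums) (auto simp: abs_mult sums_iff)
  then show ?case by simp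
qed

section \<open>Discrete random variables and transition probabilities\<close>

lemma (in prob_space) discrete_total_probability:
  fixes X :: "'a \<Rightarrow> nat"
  assumes X [measurable]: "X \<in> M \<rightarrow>\<^sub>M count_space UNIV" and A [measurable]: "{\<omega>\<in>space M. A \<omega>} \<in> events"
  shows "(\<lambda>n. prob {\<omega>\<in>space M. X \<omega> = n \<and> A \<omega>}) sums prob {\<omega>\<in>space M. A \<omega>}"
proof -
  have "range (\<lambda>n. {\<omega>\<in>space M. X \<omega> = n \<and> A \<omega>}) \<subseteq> events" by auto
  moreover have "disjoint_family (\<lambda>n. {\<omega>\<in>space M. X \<omega> = n \<and> A \<omega>})"
    by (auto simp: disjoint_family_on_def)
  ultimately have "(\<lambda>n. prob {\<omega>\<in>space M. X \<omega> = n \<and> A \<omega>}) sums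
      prob (\<Union>n. {\<omega>\<in>space M. X \<omega> = n \<and> A \<omega>})"
    by (rule finite_measure_UNION)
  moreover have "(\<Union>n. {\<omega>\<in>space M. X \<omega> = n \<and> A \<omega>}) = {\<omega>\<in>space M. A \<omega>}" by auto
  ultimately show ?thesis by simp
qed

lemma (in prob_space) discrete_expectation_sums:
  fixes X :: "'a \<Rightarrow> nat" and g :: "nat \<Rightarrow> real"
  assumes X [measurable]: "X \<in> M \<rightarrow>\<^sub>M count_space UNIV" and g: "\<And>n. \<bar>g n\<bar> \<le> B"
  shows "(\<lambda>n. prob {\<omega>\<in>space M. X \<omega> = n} * g n) sums (\<integral>\<omega>. g (X \<omega>) \<partial>M)"
proof -
  define f where "f n \<omega> = g n * indicator {\<omega>\<in>space M. X \<omega> = n} \<omega>" for n \<omega>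
  have [simp]: "{\<omega>\<in>space M. X \<omega> = n} \<inter> space M = {\<omega>\<in>space M. X \<omega> = n}" for n by auto
  have f_int: "integrable M (f n)" for n unfolding f_def by (auto simp: less_top[symmetric])
  have f_sums: "(\<lambda>n. f n \<omega>) sums g (X \<omega>)" if "\<omega> \<in> space M" for \<omega>
  proof -
    have "f n \<omega> = (if n = X \<omega> then g n else 0)" for n using that by (auto simp: f_def)
    then show ?thesis using sums_single[of "X \<omega>" g] by simp
  qed
  have f_integral: "integral\<^sup>L M (f n) = prob {\<omega>\<in>space M. X \<omega> = n} * g n" for n
    unfolding f_def by simp
  have "(\<lambda>n. integral\<^sup>L M (f n)) sums (\<integral>\<omega>. (\<Sum>n. f n \<omega>) \<partial>M)"
  proof (rule sums_integral[OF f_int])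
    show "AE \<omega> in M. summable (\<lambda>n. norm (f n \<omega>))"
    proof (rule AE_I2)
      fix \<omega> assume "\<omega> \<in> space M"
      then have "norm (f n \<omega>) = (if n = X \<omega> then \<bar>g n\<bar> else 0)" for n by (auto simp: f_def)
      then show "summable (\<lambda>n. norm (f n \<omega>))"
        using sums_single[of "X \<omega>" "\<lambda>n. \<bar>g n\<bar>"] by (simp add: sums_iff)
    qed
    have "summable (\<lambda>n. prob {\<omega>\<in>space M. X \<omega> = n})"
      using discrete_total_probability[OF X, of "\<lambda>_. True"] by (simp add: sums_iff)
    then have B: "summable (\<lambda>n. prob {\<omega>\<in>space M. X \<omega> = n} * B)" by (rule summable_mult2)
    have norm_int: "(\<integral>\<omega>. norm (f n \<omega>) \<partial>M) = prob {\<omega>\<in>space M. X \<omega> = n} * \<bar>g n\<bar>" for n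
      unfolding f_def by (simp add: abs_mult)
    show "summable (\<lambda>n. \<integral>\<omega>. norm (f n \<omega>) \<partial>M)"
      unfolding norm_int
      by (rule summable_comparison_test'[OF B, where N = 0])
         (unfold real_norm_def abs_mult abs_idempotent abs_of_nonneg[OF measure_nonneg],
          intro mult_left_mono g measure_nonneg)
  qed
  moreover have "(\<integral>\<omega>. (\<Sum>n. f n \<omega>) \<partial>M) = (\<integral>\<omega>. g (X \<omega>) \<partial>M)"
    by (intro Bochner_Integration.integral_cong refl) (use f_sums in \<open>simp add: sums_iff\<close>)
  ultimately show ?thesis by (simp add: f_integral)
qed

context homogeneous_markov_chain
begin

lemma trans_prob_nonneg: "0 \<le> trans_prob M X t i j"
  by (simp add: trans_prob_def)

lemma trans_prob_sums_1:
  assumes "i \<in> E" "0 \<le> t"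
  shows "(\<lambda>j. trans_prob M X t i j) sums 1"
proof -
  interpret prob_space "M i" using prob_spaces assms by blast
  show ?thesis
    using discrete_total_probability[OF random_variables[OF assms], of "\<lambda>_. True"]
    by (simp add: trans_prob_def prob_space)
qed

lemma trans_prob_outside:
  assumes "i \<in> E" "0 \<le> t" "j \<notin> E"
  shows "trans_prob M X t i j = 0"
proof -
  interpret prob_space "M i" using prob_spaces assms by blast
  show ?thesis unfolding trans_prob_def
    by (rule prob_eq_0_AE) (use state_space[OF assms(1,2)] assms(3) in auto)
qed

lemma trans_prob_0:
  assumes "i \<in> E"
  shows "trans_prob M X 0 i i = 1"
proof -
  interpret prob_space "M i" using prob_spaces assms by blast
  have "X 0 \<in> M i \<rightarrow>\<^sub>M count_space UNIV" using random_variables assms by simp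
  then have "{\<omega>\<in>space (M i). X 0 \<omega> = i} \<in> events" by measurable
  then show ?thesis using initial_state[OF assms] by (simp add: trans_prob_def prob_Collect_eq_1)
qed

text \<open>The Markov property is assumed only for states in \<open>E\<close> and conditioning
  events of positive probability. In all other cases both sides vanish.\<close>

lemma joint_prob:
  assumes i: "i \<in> E" and s: "0 \<le> s" and t: "0 \<le> t"
  shows "\<P>(\<omega> in M i. X s \<omega> = j \<and> X (s + t) \<omega> = k) = trans_prob M X s i j * trans_prob M X t j k"
proof -
  interpret prob_space "M i" using prob_spaces i by blast
  have [measurable]: "X s \<in> M i \<rightarrow>\<^sub>M count_space UNIV" "X (s + t) \<in> M i \<rightarrow>\<^sub>M count_space UNIV"
    using random_variables i s t by auto
  have le_j: "\<P>(\<omega> in M i. X s \<omega> = j \<and> X (s + t) \<omega> = k) \<le> trans_prob M X s i j"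
    unfolding trans_prob_def by (rule finite_measure_mono) auto
  have le_k: "\<P>(\<omega> in M i. X s \<omega> = j \<and> X (s + t) \<omega> = k) \<le> trans_prob M X (s + t) i k"
    unfolding trans_prob_def by (rule finite_measure_mono) auto
  show ?thesis
  proof (cases "trans_prob M X s i j = 0")
    case True
    then show ?thesis using le_j by (simp add: measure_le_0_iff)
  next
    case False
    then have pos: "0 < trans_prob M X s i j" using trans_prob_nonneg[of s i j] by linarith
    have j: "j \<in> E" using trans_prob_outside[OF i s] False by blast
    show ?thesis
    proof (cases "k \<in> E")
      case True
      have "\<P>(\<omega> in M i. X (s + t) \<omega> = k \<bar> (\<forall>r\<in>{}. X r \<omega> = x r) \<and> X s \<omega> = j) = trans_prob M X t j k" for x
        by (rule markov_property) (use i j True s t pos in \<open>auto simp: trans_prob_def\<close>)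
      then show ?thesis using pos by (simp add: cond_prob_def trans_prob_def conj_commute field_simps)
    next
      case False
      then show ?thesis
        using le_k trans_prob_outside[OF i _ False, of "s + t"] trans_prob_outside[OF j t False] s t
        by (simp add: measure_le_0_iff)
    qed
  qed
qed

lemma chapman_kolmogorov:
  assumes i: "i \<in> E" and s: "0 \<le> s" and t: "0 \<le> t"
  shows "(\<lambda>j. trans_prob M X s i j * trans_prob M X t j k) sums trans_prob M X (s + t) i k"
proof -
  interpret prob_space "M i" using prob_spaces i by blast
  have [measurable]: "X (s + t) \<in> M i \<rightarrow>\<^sub>M count_space UNIV"
    using random_variables i s t by auto
  show ?thesis
    using discrete_total_probability[OF random_variables[OF i s], of "\<lambda>\<omega>. X (s + t) \<omega> = k"]
    by (simp add: joint_prob[OF i s t]) (simp add: trans_prob_def)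
qed

end

subsection \<open>Generating functions of the branching process\<close>

context markov_branching_process
begin

definition p :: "real \<Rightarrow> nat \<Rightarrow> real" where "p t j = trans_prob M Z t 1 j"

definition F :: "real \<Rightarrow> real \<Rightarrow> real" where "F t x = (\<Sum>j. p t j * x ^ j)"

text \<open>Outside the state space \<open>a\<close> is unconstrained; setting it to 0 there allows
  ordinary series over all naturals.\<close>

definition rate :: "nat \<Rightarrow> real" where "rate j = (if j \<in> insert 0 S then a j else 0)"

definition f :: "real \<Rightarrow> real" where "f x = (\<Sum>j. rate j * x ^ j)"

lemma one_state: "1 \<in> insert 0 S"
  using one_in_S by simp

lemma p_nonneg: "0 \<le> p t j"
  by (simp add: p_def trans_prob_nonneg)

lemma p_sums_1: "0 \<le> t \<Longrightarrow> p t sums 1"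
  using trans_prob_sums_1[OF one_state] by (simp add: p_def[abs_def])

lemma p_outside: "0 \<le> t \<Longrightarrow> j \<notin> insert 0 S \<Longrightarrow> p t j = 0"
  using trans_prob_outside[OF one_state] by (simp add: p_def)

lemma p_summable:
  assumes "0 \<le> t" "\<bar>x\<bar> \<le> 1"
  shows "summable (\<lambda>j. \<bar>p t j * x ^ j\<bar>)" "summable (\<lambda>j. p t j * x ^ j)"
proof -
  show "summable (\<lambda>j. \<bar>p t j * x ^ j\<bar>)"
  proof (rule summable_comparison_test'[OF sums_summable[OF p_sums_1[OF assms(1)]], where N = 0])
    fix j
    have "\<bar>x\<bar> ^ j \<le> 1" using assms(2) by (simp add: power_le_one)
    then have "p t j * \<bar>x\<bar> ^ j \<le> p t j" by (intro mult_left_le p_nonneg)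
    then show "norm \<bar>p t j * x ^ j\<bar> \<le> p t j" by (simp add: abs_mult power_abs p_nonneg)
  qed
  then show "summable (\<lambda>j. p t j * x ^ j)" by (rule summable_rabs_cancel)
qed

lemma F_sums: "0 \<le> t \<Longrightarrow> \<bar>x\<bar> \<le> 1 \<Longrightarrow> (\<lambda>j. p t j * x ^ j) sums F t x"
  using p_summable by (simp add: F_def summable_sums)

lemma F_1: "0 \<le> t \<Longrightarrow> F t 1 = 1"
  using p_sums_1 by (simp add: F_def sums_iff)

lemma F_at_0: "F t 0 = p t 0"
  using powser_zero[of "p t"] by (simp add: F_def)

lemma F_nonneg: "0 \<le> t \<Longrightarrow> 0 \<le> x \<Longrightarrow> x \<le> 1 \<Longrightarrow> 0 \<le> F t x"
  unfolding F_def using p_summable p_nonneg by (intro suminf_nonneg) auto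

lemma F_mono: "0 \<le> t \<Longrightarrow> 0 \<le> x \<Longrightarrow> x \<le> y \<Longrightarrow> y \<le> 1 \<Longrightarrow> F t x \<le> F t y"
  unfolding F_def using p_summable p_nonneg by (intro suminf_le mult_left_mono power_mono) auto

lemma F_le_1: "0 \<le> t \<Longrightarrow> 0 \<le> x \<Longrightarrow> x \<le> 1 \<Longrightarrow> F t x \<le> 1"
  using F_mono[of t x 1] by (simp add: F_1)

lemma F_at_time_0:
  assumes "\<bar>x\<bar> \<le> 1"
  shows "F 0 x = x"
proof -
  have p1: "p 0 1 = 1" using trans_prob_0[OF one_state] by (simp add: p_def)
  have "p 0 j = 0" if "j \<noteq> 1" for j
  proof -
    have "sum (p 0) {1, j} \<le> suminf (p 0)"
      using p_sums_1[of 0] p_nonneg by (intro sum_le_suminf) (auto simp: sums_iff)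
    then show ?thesis using that p1 p_sums_1[of 0] p_nonneg[of 0 j] by (simp add: sums_iff)
  qed
  then have "(\<lambda>j. p 0 j * x ^ j) = (\<lambda>j. if j = 1 then x else 0)" using p1 by auto
  then show ?thesis using sums_single[of 1 "\<lambda>_. x"] by (simp add: F_def sums_iff)
qed

text \<open>The branching property is assumed only for \<open>j\<close> in the state space.
  Elsewhere the transition probability is 0 and the convolution coefficient is nonnegative; as both
  sequences have total mass 1, they agree everywhere.\<close>

lemma trans_prob_eq_coeff:
  assumes i: "i \<in> insert 0 S" and t: "0 \<le> t"
  shows "trans_prob M Z t i j = fps_nth (Abs_fps (p t) ^ i) j"
proof -
  have coeff: "trans_prob M Z t i j = fps_nth (Abs_fps (p t) ^ i) j" if "j \<in> insert 0 S" for j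
    using branching_property[OF i that t] by (simp add: p_def[abs_def])
  have nonneg: "0 \<le> fps_nth (Abs_fps (p t) ^ i) j - trans_prob M Z t i j" for j
    using coeff trans_prob_outside[OF i t] fps_power_nonneg[of "Abs_fps (p t)" i j] p_nonneg
    by (cases "j \<in> insert 0 S") auto
  have "(\<lambda>j. fps_nth (Abs_fps (p t) ^ i) j * 1 ^ j) sums (F t 1 ^ i)"
    by (rule fps_power_sums) (use p_nonneg p_sums_1[OF t] t in \<open>auto simp: F_1\<close>)
  then have "(\<lambda>j. fps_nth (Abs_fps (p t) ^ i) j) sums 1" using t by (simp add: F_1)
  from sums_diff[OF this trans_prob_sums_1[OF i t]]
  have "(\<lambda>j. fps_nth (Abs_fps (p t) ^ i) j - trans_prob M Z t i j) sums 0" by simp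
  then have "\<forall>j. fps_nth (Abs_fps (p t) ^ i) j - trans_prob M Z t i j = 0"
    using suminf_eq_zero_iff[of "\<lambda>j. fps_nth (Abs_fps (p t) ^ i) j - trans_prob M Z t i j"] nonneg
    by (auto simp: sums_iff)
  then show ?thesis by simp
qed

lemma trans_prob_power_sums:
  assumes "i \<in> insert 0 S" "0 \<le> t" "0 \<le> x" "x \<le> 1"
  shows "(\<lambda>j. trans_prob M Z t i j * x ^ j) sums F t x ^ i"
  using fps_power_sums[of "Abs_fps (p t)" x "F t x" i] F_sums[of t x] assms p_nonneg
  by (simp add: trans_prob_eq_coeff)

lemma p_add_sums:
  assumes "0 \<le> s" "0 \<le> t"
  shows "(\<lambda>k. p s k * fps_nth (Abs_fps (p t) ^ k) j) sums p (s + t) j"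
proof -
  have eq: "p s k * trans_prob M Z t k j = p s k * fps_nth (Abs_fps (p t) ^ k) j" for k
    using trans_prob_eq_coeff[of k t j] p_outside[of s k] assms by (cases "k \<in> insert 0 S") auto
  have "(\<lambda>k. p s k * trans_prob M Z t k j) sums p (s + t) j"
    using chapman_kolmogorov[OF one_state assms, of j] by (simp add: p_def)
  then show ?thesis unfolding eq .
qed

lemma F_semigroup:
  assumes s: "0 \<le> s" and t: "0 \<le> t" and x: "0 \<le> x" "x \<le> 1"
  shows "F (s + t) x = F s (F t x)"
proof -
  let ?c = "\<lambda>k j. fps_nth (Abs_fps (p t) ^ k) j"
  have rows: "(\<lambda>j. p s k * ?c k j * x ^ j) sums (p s k * F t x ^ k)" for k
    using sums_mult[OF fps_power_sums[of "Abs_fps (p t)" x "F t x" k], of "p s k"]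
      p_nonneg F_sums[of t x] t x by (simp add: mult.assoc)
  have total: "(\<lambda>k. p s k * F t x ^ k) sums F s (F t x)"
    using F_sums[OF s, of "F t x"] F_nonneg[OF t x] F_le_1[OF t x] by simp
  have "(\<lambda>j. \<Sum>k. p s k * ?c k j * x ^ j) sums F s (F t x)"
    by (rule sums_swap_nonneg(2)[OF _ rows total])
       (use p_nonneg fps_power_nonneg[of "Abs_fps (p t)"] x in auto)
  moreover have eq: "(\<Sum>k. p s k * ?c k j * x ^ j) = p (s + t) j * x ^ j" for j
    by (rule sums_unique[OF sums_mult2[OF p_add_sums[OF s t, of j], of "x ^ j"], symmetric])
  ultimately have "(\<lambda>j. p (s + t) j * x ^ j) sums F s (F t x)" by (simp only:)
  from sums_unique[OF this] show ?thesis by (simp only: F_def[of "s + t"])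
qed

section \<open>Uniform small-time expansion of the generating function\<close>

lemma p_small_time:
  "((\<lambda>h. (p h j - (if j = 1 then 1 else 0)) / h) \<longlongrightarrow> rate j) (at_right 0)"
proof (cases "j \<in> insert 0 S")
  case True
  have nz: "eventually (\<lambda>h::real. h \<noteq> 0) (at_right 0)"
    by (auto simp: eventually_at_right_field intro!: exI[of _ 1])
  have "((\<lambda>h. (trans_prob M Z h 1 j - ((if j = 1 then 1 else 0) + a j * h)) / h) \<longlongrightarrow> 0) (at_right 0)"
    using smalloD_tendsto[OF infinitesimal[OF True]] .
  from tendsto_add[OF this tendsto_const[of "a j"]]
  have lim: "((\<lambda>h. (trans_prob M Z h 1 j - ((if j = 1 then 1 else 0) + a j * h)) / h + a j) \<longlongrightarrow> a j) (at_right 0)"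
    by simp
  have "((\<lambda>h. (p h j - (if j = 1 then 1 else 0)) / h) \<longlongrightarrow> a j) (at_right 0)"
    by (rule Lim_transform_eventually[OF lim])
       (use nz in eventually_elim, auto simp: p_def field_simps)
  then show ?thesis using True by (simp add: rate_def)
next
  case False
  then have "j \<noteq> 1" using one_in_S by auto
  have "eventually (\<lambda>h. (p h j - (if j = 1 then 1 else 0)) / h = 0) (at_right 0)"
    using False p_outside \<open>j \<noteq> 1\<close> by (auto simp: eventually_at_right_field intro!: exI[of _ 1])
  then show ?thesis using False by (auto simp: rate_def intro: tendsto_eventually)
qed

text \<open>A weighted l1 distance between difference quotients and rates. Since the weights
  increase with \<open>x\<close>, it bounds the error at every \<open>y\<close> in
  \<open>[0, x]\<close> at once.\<close>

definition generator_error :: "real \<Rightarrow> real \<Rightarrow> real"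
  where "generator_error x h = (\<Sum>j. \<bar>(p h j - (if j = 1 then 1 else 0)) / h - rate j\<bar> * x ^ j)"

text \<open>For \<open>j \<noteq> 1\<close> the mass at \<open>j\<close> is at most
  \<open>1 - p h 1\<close>, so the convergent quotient at index 1 dominates all others. This
  supplies the majorant for dominated convergence of series.\<close>

lemma small_time_bounds:
  obtains C where "0 < C" "eventually (\<lambda>h. \<forall>j. \<bar>(p h j - (if j = 1 then 1 else 0)) / h\<bar> \<le> C) (at_right 0)"
    "\<And>j. \<bar>rate j\<bar> \<le> C"
proof -
  define q where "q h j = (p h j - (if j = 1 then 1 else 0)) / h" for h j
  define C where "C = \<bar>rate 1\<bar> + 1"
  have "eventually (\<lambda>h. \<bar>q h 1 - rate 1\<bar> < 1) (at_right 0)"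
    using tendstoD[OF p_small_time[of 1], of 1] by (simp add: q_def dist_real_def)
  moreover have "eventually (\<lambda>h::real. 0 < h) (at_right 0)" by (simp add: eventually_at_right_less)
  ultimately have ev: "eventually (\<lambda>h. \<forall>j. \<bar>q h j\<bar> \<le> C) (at_right 0)"
  proof eventually_elim
    case (elim h)
    have q1: "\<bar>q h 1\<bar> \<le> C" using elim(1) by (simp add: C_def)
    have "\<bar>q h j\<bar> \<le> C" if "j \<noteq> 1" for j
    proof -
      have "sum (p h) {1, j} \<le> suminf (p h)"
        using p_sums_1[of h] p_nonneg elim by (intro sum_le_suminf) (auto simp: sums_iff)
      then have "p h j \<le> 1 - p h 1" using p_sums_1[of h] elim that by (simp add: sums_iff)
      then have "p h j / h \<le> (1 - p h 1) / h" using elim by (intro divide_right_mono) auto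
      moreover have "- q h 1 = (1 - p h 1) / h" by (simp add: q_def minus_divide_left)
      ultimately have "q h j \<le> - q h 1" "0 \<le> q h j"
        using elim that p_nonneg[of h j] by (simp_all add: q_def)
      then show ?thesis using q1 by linarith
    qed
    with q1 show ?case by metis
  qed
  have "\<bar>rate j\<bar> \<le> C" for j
  proof (rule tendsto_upperbound)
    show "((\<lambda>h. \<bar>q h j\<bar>) \<longlongrightarrow> \<bar>rate j\<bar>) (at_right 0)"
      using p_small_time[of j] unfolding q_def by (rule tendsto_rabs)
    show "eventually (\<lambda>h. \<bar>q h j\<bar> \<le> C) (at_right 0)" using ev by eventually_elim auto
  qed simp
  with ev show ?thesis by (intro that[of C]) (auto simp: C_def q_def)
qed

lemma rate_summable:
  assumes "\<bar>x\<bar> < 1"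
  shows "summable (\<lambda>j. \<bar>rate j * x ^ j\<bar>)" "summable (\<lambda>j. rate j * x ^ j)"
proof -
  obtain C where C: "\<And>j. \<bar>rate j\<bar> \<le> C" using small_time_bounds by metis
  have "summable (\<lambda>j. C * \<bar>x\<bar> ^ j)" using assms by (intro summable_mult summable_geometric) auto
  then show "summable (\<lambda>j. \<bar>rate j * x ^ j\<bar>)"
    by (rule summable_comparison_test'[where N = 0]) (auto simp: abs_mult power_abs intro!: mult_right_mono C)
  then show "summable (\<lambda>j. rate j * x ^ j)" by (rule summable_rabs_cancel)
qed

lemma f_continuous: "continuous_on {-1<..<1} f"
proof -
  have "isCont f x" if "\<bar>x\<bar> < 1" for x
    unfolding f_def
    by (rule DERIV_isCont[OF termdiffs_strong'[of 1]]) (use that rate_summable in auto)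
  then show ?thesis by (intro continuous_at_imp_continuous_on ballI) (simp add: abs_less_iff)
qed

lemma generator_error_tendsto_0:
  assumes x: "0 \<le> x" "x < 1"
  shows "(generator_error x \<longlongrightarrow> 0) (at_right 0)"
proof -
  define q where "q h j = (p h j - (if j = 1 then 1 else 0)) / h" for h j
  obtain C where C: "0 < C" "eventually (\<lambda>h. \<forall>j. \<bar>q h j\<bar> \<le> C) (at_right 0)" "\<And>j. \<bar>rate j\<bar> \<le> C"
    using small_time_bounds unfolding q_def by blast
  have "((\<lambda>h. \<Sum>j. \<bar>q h j - rate j\<bar> * x ^ j) \<longlongrightarrow> (\<Sum>j. 0)) (at_right 0)"
  proof (rule tannerys_theorem[THEN conjunct2, THEN conjunct2])
    show "((\<lambda>h. \<bar>q h j - rate j\<bar> * x ^ j) \<longlongrightarrow> 0) (at_right 0)" for j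
    proof -
      have "((\<lambda>h. q h j) \<longlongrightarrow> rate j) (at_right 0)" using p_small_time[of j] by (simp add: q_def)
      then have "((\<lambda>h. \<bar>q h j - rate j\<bar>) \<longlongrightarrow> 0) (at_right 0)"
        using LIM_zero tendsto_rabs_zero by blast
      then show ?thesis by (rule tendsto_mult_left_zero)
    qed
    show "eventually (\<lambda>(j, h). norm (\<bar>q h j - rate j\<bar> * x ^ j) \<le> 2 * C * x ^ j) (at_top \<times>\<^sub>F at_right 0)"
    proof -
      have "eventually (\<lambda>(j :: nat, h). \<forall>j. \<bar>q h j\<bar> \<le> C) (at_top \<times>\<^sub>F at_right 0)"
        using eventually_prod2[of "at_top :: nat filter" "\<lambda>h. \<forall>j. \<bar>q h j\<bar> \<le> C" "at_right 0"] C(2) by (simp add: case_prod_beta)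
      then show ?thesis
      proof (rule eventually_mono)
        fix z :: "nat \<times> real" assume *: "case z of (j, h) \<Rightarrow> \<forall>j. \<bar>q h j\<bar> \<le> C"
        obtain j h where z: "z = (j, h)" by (cases z)
        have "\<bar>q h j - rate j\<bar> \<le> \<bar>q h j\<bar> + \<bar>rate j\<bar>" by (rule abs_triangle_ineq4)
        also have "\<bar>q h j\<bar> \<le> C" using * unfolding z by simp
        finally have "\<bar>q h j - rate j\<bar> \<le> 2 * C" using C(3)[of j] by simp
        then show "case z of (j, h) \<Rightarrow> norm (\<bar>q h j - rate j\<bar> * x ^ j) \<le> 2 * C * x ^ j"
          using z x by (auto simp: abs_mult intro!: mult_right_mono)
      qed
    qed
    show "summable (\<lambda>j. 2 * C * x ^ j)" using x by (intro summable_mult summable_geometric) auto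
  qed simp
  then show ?thesis by (simp add: generator_error_def[abs_def] q_def)
qed

text \<open>Uniformity over \<open>y \<le> x\<close> matters because the expansion is later applied
  at moving points \<open>y = F u x\<close>.\<close>

lemma F_small_time:
  assumes h: "0 < h" and x: "0 \<le> x" "x < 1" and y: "0 \<le> y" "y \<le> x"
  shows "\<bar>F h y - y - h * f y\<bar> \<le> h * generator_error x h"
proof -
  define q where "q j = (p h j - (if j = 1 then 1 else 0)) / h" for j
  have "(\<lambda>j. p h j * y ^ j - (if j = 1 then y else 0)) sums (F h y - y)"
    using F_sums[of h y] sums_single[of 1 "\<lambda>_. y"] h x y by (intro sums_diff) auto
  then have "(\<lambda>j. (p h j * y ^ j - (if j = 1 then y else 0)) / h) sums ((F h y - y) / h)"
    by (rule sums_divide)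
  moreover have "(p h j * y ^ j - (if j = 1 then y else 0)) / h = q j * y ^ j" for j
    using h by (simp add: q_def field_simps)
  ultimately have q: "(\<lambda>j. q j * y ^ j) sums ((F h y - y) / h)" by simp
  have fs: "(\<lambda>j. rate j * y ^ j) sums f y"
    unfolding f_def using rate_summable[of y] x y by (intro summable_sums) auto
  have diff: "(\<lambda>j. (q j - rate j) * y ^ j) sums ((F h y - y) / h - f y)"
    using sums_diff[OF q fs] by (simp add: algebra_simps)
  have "summable (\<lambda>j. \<bar>p h j * x ^ j\<bar> / h + (if j = 1 then x / h else 0) + \<bar>rate j * x ^ j\<bar>)"
    using p_summable[of h x] rate_summable[of x] h x sums_single[of 1 "\<lambda>_. x / h", THEN sums_summable]
    by (intro summable_add summable_divide) auto
  then have sx: "summable (\<lambda>j. \<bar>q j - rate j\<bar> * x ^ j)"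
  proof (rule summable_comparison_test'[where N = 0])
    fix j
    have "(q j - rate j) * x ^ j = p h j * x ^ j / h - (if j = 1 then x / h else 0) - rate j * x ^ j"
      using h by (simp add: q_def field_simps)
    then have "\<bar>q j - rate j\<bar> * x ^ j = \<bar>p h j * x ^ j / h - (if j = 1 then x / h else 0) - rate j * x ^ j\<bar>"
      using x by (metis abs_mult abs_of_nonneg zero_le_power)
    also have "\<dots> \<le> \<bar>p h j * x ^ j / h\<bar> + \<bar>if j = 1 then x / h else 0\<bar> + \<bar>rate j * x ^ j\<bar>"
      by linarith
    also have "\<dots> = \<bar>p h j * x ^ j\<bar> / h + (if j = 1 then x / h else 0) + \<bar>rate j * x ^ j\<bar>"
      using h x by (simp add: abs_mult)
    finally show "norm (\<bar>q j - rate j\<bar> * x ^ j) \<le>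
      \<bar>p h j * x ^ j\<bar> / h + (if j = 1 then x / h else 0) + \<bar>rate j * x ^ j\<bar>"
      using x by (simp add: abs_mult)
  qed
  have le: "\<bar>(q j - rate j) * y ^ j\<bar> \<le> \<bar>q j - rate j\<bar> * x ^ j" for j
    using y by (auto simp: abs_mult intro!: mult_left_mono power_mono)
  have sy: "summable (\<lambda>j. \<bar>(q j - rate j) * y ^ j\<bar>)"
    by (rule summable_comparison_test'[OF sx, where N = 0]) (use le in auto)
  have "\<bar>(F h y - y) / h - f y\<bar> \<le> (\<Sum>j. \<bar>(q j - rate j) * y ^ j\<bar>)"
    using summable_rabs[OF sy] diff by (simp add: sums_iff)
  also have "\<dots> \<le> generator_error x h"
    unfolding generator_error_def q_def[symmetric] by (rule suminf_le[OF le sy sx])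
  finally have "h * \<bar>(F h y - y) / h - f y\<bar> \<le> h * generator_error x h"
    using h by (intro mult_left_mono) auto
  moreover have "h * \<bar>(F h y - y) / h - f y\<bar> = \<bar>h * ((F h y - y) / h - f y)\<bar>"
    using h by (simp add: abs_mult)
  moreover have "h * ((F h y - y) / h - f y) = F h y - y - h * f y"
    using h by (simp add: field_simps)
  ultimately show ?thesis by simp
qed

section \<open>Differential equations in time and space\<close>

lemma p_tendsto: "((\<lambda>h. p h j) \<longlongrightarrow> (if j = 1 then 1 else 0)) (at_right 0)"
proof -
  have "((\<lambda>h. (p h j - (if j = 1 then 1 else 0)) / h * h + (if j = 1 then 1 else 0)) \<longlongrightarrow>
      rate j * 0 + (if j = 1 then 1 else 0)) (at_right 0)"
    by (intro tendsto_intros p_small_time)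
  then have lim: "((\<lambda>h. (p h j - (if j = 1 then 1 else 0)) / h * h + (if j = 1 then 1 else 0)) \<longlongrightarrow>
      (if j = 1 then 1 else 0)) (at_right 0)" by simp
  have "eventually (\<lambda>h::real. 0 < h) (at_right 0)" by (simp add: eventually_at_right_less)
  then show ?thesis
    by (intro Lim_transform_eventually[OF lim]) (elim eventually_mono, simp)
qed

text \<open>On \<open>[0, 1]\<close> the convex function \<open>F t\<close> lies below the chord
  joining its values \<open>p t 0\<close> at 0 and 1 at 1.\<close>

lemma F_le:
  assumes t: "0 \<le> t" and x: "0 \<le> x" "x \<le> 1"
  shows "F t x \<le> x + (1 - x) * p t 0"
proof (rule sums_le)
  show "(\<lambda>j. p t j * x ^ j) sums F t x" using F_sums t x by simp
  show "(\<lambda>j. x * p t j + (if j = 0 then (1 - x) * p t 0 else 0)) sums (x + (1 - x) * p t 0)"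
    using sums_add[OF sums_mult[OF p_sums_1[OF t], of x] sums_single[of 0 "\<lambda>_. (1 - x) * p t 0"]] by simp
  show "p t j * x ^ j \<le> x * p t j + (if j = 0 then (1 - x) * p t 0 else 0)" for j
  proof (cases j)
    case (Suc n)
    have "x ^ Suc n \<le> x" using x power_le_one[of x n] by (simp add: mult_left_le)
    then have "p t (Suc n) * x ^ Suc n \<le> p t (Suc n) * x" by (intro mult_left_mono p_nonneg)
    then show ?thesis using Suc by (simp add: mult.commute)
  qed (simp add: algebra_simps)
qed

text \<open>For a short time \<open>h\<close> the extinction probability is below 1, so by
  \<open>F_le\<close> the map \<open>F h\<close> keeps \<open>[0, 1)\<close> invariant. The
  semigroup law then covers time \<open>t\<close> in \<open>n\<close> steps of length
  \<open>t / n\<close>.\<close>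

lemma F_less_1:
  assumes t: "0 \<le> t" and x: "0 \<le> x" "x < 1"
  shows "F t x < 1"
proof (cases "t = 0")
  case False
  have "eventually (\<lambda>h. p h 0 < 1) (at_right 0)"
    using order_tendstoD(2)[OF p_tendsto[of 0], of 1] by simp
  then obtain d where d: "0 < d" "\<And>h. 0 < h \<Longrightarrow> h < d \<Longrightarrow> p h 0 < 1"
    by (auto simp: eventually_at_right_field)
  obtain n where n: "t / d < real n" using reals_Archimedean2 by blast
  have "0 < t / d" using t d False by auto
  then have n0: "0 < real n" using n by linarith
  define h where "h = t / real n"
  have h: "0 < h" "h < d" using n n0 d t False by (auto simp: h_def field_simps)
  have step: "F h y < 1" if "0 \<le> y" "y < 1" for y
  proof -
    have "(1 - y) * p h 0 < (1 - y) * 1" using d(2)[OF h] that by (intro mult_strict_left_mono) auto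
    then have "y + (1 - y) * p h 0 < 1" by (simp add: algebra_simps)
    then show ?thesis using F_le[of h y] h that by simp
  qed
  have "F (real k * h) x < 1" for k
  proof (induction k)
    case (Suc k)
    have "F (h + real k * h) x = F h (F (real k * h) x)"
      using h x by (intro F_semigroup) auto
    then show ?case using step[of "F (real k * h) x"] F_nonneg[of "real k * h" x] Suc h x
      by (simp add: algebra_simps)
  qed (use x F_at_time_0[of x] in simp)
  from this[of n] show ?thesis using n0 by (simp add: h_def)
qed (use x F_at_time_0[of x] in simp)

lemma p0_mono:
  assumes "0 \<le> s" "s \<le> t"
  shows "p s 0 \<le> p t 0"
proof -
  have "F s 0 \<le> F s (F (t - s) 0)"
    using assms F_nonneg[of "t - s" 0] F_le_1[of "t - s" 0] by (intro F_mono) auto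
  also have "\<dots> = F t 0" using F_semigroup[of s "t - s" 0] assms by simp
  finally show ?thesis by (simp add: F_at_0)
qed

lemma F_time_deriv:
  assumes t: "0 \<le> t" and x: "0 \<le> x" "x < 1"
  shows "((\<lambda>t. F t x) has_real_derivative f (F t x)) (at t within {0..})"
proof -
  \<comment> \<open>A bound below 1 for all \<open>F u x\<close> with \<open>u \<le> t + 1\<close>,
    from \<open>F_le\<close> and monotonicity of \<open>p u 0\<close>; the margin 1 leaves room on
    the right of \<open>t\<close>.\<close>
  define m where "m = x + (1 - x) * p (t + 1) 0"
  have "F (t + 1) 0 < 1" using F_less_1[of "t + 1" 0] t by simp
  then have "(1 - x) * p (t + 1) 0 < (1 - x) * 1"
    using x by (intro mult_strict_left_mono) (auto simp: F_at_0)
  then have "m < 1" unfolding m_def by (simp add: algebra_simps)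
  moreover have "0 \<le> m" using x p_nonneg by (simp add: m_def)
  ultimately have m: "0 \<le> m" "m < 1" by auto
  have range: "0 \<le> F u x" "F u x \<le> m" if "0 \<le> u" "u \<le> t + 1" for u
  proof -
    have "(1 - x) * p u 0 \<le> (1 - x) * p (t + 1) 0"
      using p0_mono[OF that] x by (intro mult_left_mono) auto
    then have "x + (1 - x) * p u 0 \<le> m" unfolding m_def by (rule add_left_mono)
    then show "F u x \<le> m" using F_le[of u x] that x by simp
  qed (use that x F_nonneg in auto)
  have "continuous_on {0..m} f" using f_continuous by (rule continuous_on_subset) (use m in auto)
  then have "bounded (f ` {0..m})" by (intro compact_imp_bounded compact_continuous_image) auto
  then obtain B where B: "\<And>y. y \<in> {0..m} \<Longrightarrow> \<bar>f y\<bar> \<le> B"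
    unfolding bounded_iff real_norm_def by blast
  define quot where "quot v = (F v x - F t x) / (v - t)" for v
  define e where "e v = generator_error m \<bar>v - t\<bar>" for v
  let ?A = "at t within {0..}"
  have near: "eventually (\<lambda>v. 0 \<le> v \<and> v \<noteq> t \<and> \<bar>v - t\<bar> < 1) ?A"
    unfolding eventually_at by (intro exI[of _ 1]) (auto simp: dist_real_def)
  have "((\<lambda>v. \<bar>v - t\<bar>) \<longlongrightarrow> \<bar>t - t\<bar>) ?A" by (intro tendsto_intros)
  then have h_lim: "((\<lambda>v. \<bar>v - t\<bar>) \<longlongrightarrow> 0) ?A" by simp
  then have "filterlim (\<lambda>v. \<bar>v - t\<bar>) (at_right 0) ?A"
    unfolding filterlim_at using near by (auto elim: eventually_mono)
  then have e_lim: "(e \<longlongrightarrow> 0) ?A"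
    unfolding e_def by (rule filterlim_compose[OF generator_error_tendsto_0[OF m]])
  \<comment> \<open>Both one-sided quotients are forward increments from the earlier time
    \<open>min v t\<close> over the length \<open>\<bar>v - t\<bar>\<close>, so one expansion covers
    both sides.\<close>
  have quot_near: "eventually (\<lambda>v. \<bar>quot v - f (F (min v t) x)\<bar> \<le> e v) ?A"
    using near
  proof eventually_elim
    case (elim v)
    define u where "u = min v t"
    define h where "h = \<bar>v - t\<bar>"
    have u: "0 \<le> u" "u \<le> t + 1" "0 < h" using elim t by (auto simp: u_def h_def)
    have "quot v = (F (h + u) x - F u x) / h"
      by (cases "v < t") (use elim in \<open>auto simp: quot_def u_def h_def min_def field_simps\<close>)
    moreover have "F (h + u) x = F h (F u x)" using u x by (intro F_semigroup) auto
    ultimately have q: "h * quot v = F h (F u x) - F u x" using u by simp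
    have "\<bar>F h (F u x) - F u x - h * f (F u x)\<bar> \<le> h * generator_error m h"
      using u m range[of u] by (intro F_small_time) auto
    then have "h * \<bar>quot v - f (F u x)\<bar> \<le> h * e v"
      unfolding q[symmetric] right_diff_distrib[symmetric] abs_mult
      using u by (simp add: e_def h_def)
    then show ?case using u by (simp add: u_def)
  qed
  \<comment> \<open>For \<open>v < t\<close> the base point moves with \<open>v\<close>, so
    continuity of \<open>F\<close> in time must be secured before the limit of
    \<open>f (F (min v t) x)\<close> can be taken.\<close>
  have small: "eventually (\<lambda>v. \<bar>F v x - F t x\<bar> \<le> \<bar>v - t\<bar> * (B + e v)) ?A"
    using quot_near near
  proof eventually_elim
    case (elim v)
    have "\<bar>f (F (min v t) x)\<bar> \<le> B" using B range[of "min v t"] elim t by auto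
    then have "\<bar>quot v\<bar> \<le> B + e v" using elim by linarith
    then have "\<bar>v - t\<bar> * \<bar>quot v\<bar> \<le> \<bar>v - t\<bar> * (B + e v)" by (intro mult_left_mono) auto
    moreover have "\<bar>v - t\<bar> * \<bar>quot v\<bar> = \<bar>F v x - F t x\<bar>" using elim by (simp add: quot_def)
    ultimately show ?case by simp
  qed
  have "((\<lambda>v. \<bar>v - t\<bar> * (B + e v)) \<longlongrightarrow> 0 * (B + 0)) ?A"
    by (intro tendsto_intros h_lim e_lim)
  then have small_lim: "((\<lambda>v. \<bar>v - t\<bar> * (B + e v)) \<longlongrightarrow> 0) ?A" by simp
  have "((\<lambda>v. F (min v t) x - F t x) \<longlongrightarrow> 0) ?A"
    by (rule Lim_null_comparison[OF _ small_lim])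
       (use small in \<open>auto simp: min_def elim!: eventually_mono\<close>)
  then have "((\<lambda>v. F (min v t) x) \<longlongrightarrow> F t x) ?A" by (simp add: LIM_zero_iff)
  moreover have "isCont f (F t x)"
    using f_continuous range[of t] t m by (auto simp: continuous_on_eq_continuous_at)
  ultimately have fl: "((\<lambda>v. f (F (min v t) x)) \<longlongrightarrow> f (F t x)) ?A"
    by (rule isCont_tendsto_compose[rotated])
  have "((\<lambda>v. quot v - f (F (min v t) x)) \<longlongrightarrow> 0) ?A"
    by (rule Lim_null_comparison[OF _ e_lim]) (use quot_near in simp)
  from tendsto_add[OF this fl] have "(quot \<longlongrightarrow> f (F t x)) ?A" by simp
  then show ?thesis by (simp add: has_field_derivative_iff quot_def[abs_def])
qed

lemma F_time_deriv_at:
  assumes t: "0 < t" and x: "0 \<le> x" "x < 1"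
  shows "DERIV (\<lambda>t. F t x) t :> f (F t x)"
proof -
  have "{0::real..} \<inter> {0<..} = {0<..}" by auto
  then have "at t within {0..} = at t"
    using t at_within_nhd[of t "{0<..}" "{0..}" UNIV] by simp
  then show ?thesis using F_time_deriv[of t x] t x by simp
qed

definition dF :: "real \<Rightarrow> real \<Rightarrow> real" where "dF t x = (\<Sum>n. diffs (p t) n * x ^ n)"

lemma F_space_deriv:
  assumes "0 \<le> t" "\<bar>x\<bar> < 1"
  shows "DERIV (F t) x :> dF t x"
  unfolding F_def dF_def
  by (rule termdiffs_strong'[of 1]) (use assms p_summable in auto)

lemma dF_sums:
  assumes "0 \<le> t" "\<bar>x\<bar> < 1"
  shows "(\<lambda>n. diffs (p t) n * x ^ n) sums dF t x"
  unfolding dF_def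
  by (rule summable_sums, rule termdiff_converges[where K = 1]) (use assms p_summable in auto)

text \<open>The common value \<open>F (t + h) x = F t (F h x)\<close> is differentiated from the
  right at \<open>h = 0\<close> in both forms: as a function of total time, and through the inner
  argument.\<close>

lemma dF_eq:
  assumes t: "0 \<le> t" and x: "0 \<le> x" "x < 1"
  shows "dF t x * f x = f (F t x)"
proof -
  have "((\<lambda>h. F h x) has_real_derivative f x) (at 0 within {0..})"
    using F_time_deriv[of 0 x] F_at_time_0[of x] x by simp
  moreover have "DERIV (F t) (F 0 x) :> dF t x"
    using F_space_deriv[of t x] F_at_time_0[of x] t x by simp
  ultimately have D1: "((\<lambda>h. F t (F h x)) has_real_derivative dF t x * f x) (at 0 within {0..})"
    by (rule DERIV_chain2[rotated])
  have "((\<lambda>h. t + h) has_real_derivative 1) (at 0 within {0..})" by (auto intro!: derivative_eq_intros)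
  moreover have "((\<lambda>t. F t x) has_real_derivative f (F t x)) (at (t + 0) within (\<lambda>h. t + h) ` {0..})"
    using F_time_deriv[OF t x] t by (auto intro: has_field_derivative_subset)
  ultimately have "((\<lambda>t. F t x) \<circ> (\<lambda>h. t + h) has_real_derivative f (F t x) * 1) (at 0 within {0..})"
    using DERIV_image_chain by blast
  then have D2: "((\<lambda>h. F (t + h) x) has_real_derivative f (F t x)) (at 0 within {0..})"
    by (simp add: o_def)
  have D2': "((\<lambda>h. F t (F h x)) has_real_derivative f (F t x)) (at 0 within {0..})"
    by (rule has_field_derivative_transform_within[OF D2, of 1])
       (use F_semigroup[OF t] x in auto)
  show ?thesis by (rule has_field_derivative_unique[OF D1 D2']) (simp add: at_within_Ici_at_right)
qed

end

section \<open>Long-time behaviour of the generating function\<close>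

lemma (in regular_rate) rate_mult_bounded_below:
  assumes "0 < \<epsilon>" "\<epsilon> \<le> 1"
  obtains c where "0 < c" "\<And>y. y \<in> {\<epsilon>..1} \<Longrightarrow> c \<le> y * \<Lambda> y"
proof -
  obtain m where m: "0 < m" "\<And>y. y \<in> {\<epsilon>..1} \<Longrightarrow> m \<le> \<Lambda> y"
    using rate_bounded_below[OF assms] by blast
  show ?thesis
    by (rule that[of "\<epsilon> * m"]) (use m assms in \<open>auto intro!: mult_mono\<close>)
qed

locale critical_branching =
  markov_branching_process M Z S a + regular_rate \<nu> \<Lambda> \<Lambda>' \<delta>
  for M :: "nat \<Rightarrow> 'w measure" and Z S a \<nu> \<Lambda> \<Lambda>' \<delta> +
  assumes crit: "critical S a"
    and f_eq: "\<And>y. y \<in> {0<..1} \<Longrightarrow> inf_gen_fun S a (1 - y) = y * \<Lambda> y"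
begin

lemma inf_gen_fun_eq_f:
  assumes "\<bar>x\<bar> < 1"
  shows "inf_gen_fun S a x = f x"
proof -
  have "((\<lambda>j. rate j * x ^ j) has_sum f x) UNIV"
    unfolding f_def using rate_summable[OF assms] summable_sums
    by (intro norm_summable_imp_has_sum) auto
  then have "((\<lambda>j. a j * x ^ j) has_sum f x) (insert 0 S)"
    by (rule has_sum_cong_neutral[THEN iffD1, rotated -1]) (auto simp: rate_def)
  then show ?thesis unfolding inf_gen_fun_def by (rule infsumI)
qed

lemma f_rate: "0 \<le> x \<Longrightarrow> x < 1 \<Longrightarrow> f x = (1 - x) * \<Lambda> (1 - x)"
  using f_eq[of "1 - x"] inf_gen_fun_eq_f[of x] by simp

lemma f_pos: "0 \<le> x \<Longrightarrow> x < 1 \<Longrightarrow> 0 < f x"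
  using rate_pos[of "1 - x"] by (simp add: f_rate)

lemma F_growth:
  assumes st: "0 \<le> s" "s \<le> t" and x: "0 \<le> x" "x < 1"
    and c: "\<And>u. s < u \<Longrightarrow> u < t \<Longrightarrow> c \<le> f (F u x)"
  shows "F s x + c * (t - s) \<le> F t x"
proof -
  have "F s x - c * s \<le> F t x - c * t"
  proof (rule DERIV_nonneg_imp_increasing_open[OF st(2), where f = "\<lambda>u. F u x - c * u"])
    show "\<exists>y. DERIV (\<lambda>u. F u x - c * u) u :> y \<and> y \<ge> 0" if "s < u" "u < t" for u
      by (intro exI[of _ "f (F u x) - c"] conjI)
         (use that st x c in \<open>auto intro!: derivative_eq_intros F_time_deriv_at\<close>)
    have "continuous_on {0..} (\<lambda>u. F u x)" using F_time_deriv x by (intro DERIV_continuous_on) auto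
    then have "continuous_on {s..t} (\<lambda>u. F u x)" by (rule continuous_on_subset) (use st in auto)
    then show "continuous_on {s..t} (\<lambda>u. F u x - c * u)" by (intro continuous_intros)
  qed
  then show ?thesis by (simp add: algebra_simps)
qed

lemma F_time_mono:
  assumes "0 \<le> s" "s \<le> t" "0 \<le> x" "x < 1"
  shows "F s x \<le> F t x"
  using F_growth[of s t x 0] assms f_pos F_less_1 F_nonneg by (auto simp: less_imp_le)

lemma F_ge:
  assumes "0 \<le> t" "0 \<le> x" "x \<le> 1"
  shows "x \<le> F t x"
  using F_time_mono[of 0 t x] assms F_at_time_0[of x] by (cases "x = 1") (auto simp: F_1)

text \<open>If \<open>F\<close> stayed below some level less than 1, its velocity
  \<open>f (F)\<close> would be at least some \<open>c > 0\<close>; after time \<open>2 / c\<close>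
  it would have gained 2 and left \<open>[0, 1]\<close>.\<close>

lemma F_tendsto_1:
  assumes x: "0 \<le> x" "x < 1"
  shows "((\<lambda>t. F t x) \<longlongrightarrow> 1) at_top"
proof (rule order_tendstoI)
  fix m :: real assume m: "m < 1"
  have "\<exists>t\<ge>0. m < F t x"
  proof (rule ccontr)
    assume "\<not> ?thesis"
    then have le: "F t x \<le> max m x" if "0 \<le> t" for t using that by (auto simp: le_max_iff_disj not_less)
    define \<epsilon> where "\<epsilon> = 1 - max m x"
    obtain c where c: "0 < c" "\<And>y. y \<in> {\<epsilon>..1} \<Longrightarrow> c \<le> y * \<Lambda> y"
      by (rule rate_mult_bounded_below[of \<epsilon>]) (use m x in \<open>auto simp: \<epsilon>_def\<close>)
    have "F 0 x + c * (2 / c - 0) \<le> F (2 / c) x"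
      using c(1) x
    proof (intro F_growth)
      fix u :: real assume "0 < u"
      then show "c \<le> f (F u x)"
        using le[of u] F_nonneg[of u x] F_less_1[of u x] x c(2)[of "1 - F u x"] by (simp add: f_rate \<epsilon>_def)
    qed auto
    then show False using c(1) x F_at_time_0[of x] F_le_1[of "2 / c" x] by simp
  qed
  then obtain t where t: "0 \<le> t" "m < F t x" by blast
  show "eventually (\<lambda>t. m < F t x) at_top"
    using eventually_ge_at_top[of t]
  proof eventually_elim
    case (elim u)
    then show ?case using F_time_mono[of t u x] t x by linarith
  qed
next
  fix m :: real assume "1 < m"
  show "eventually (\<lambda>t. F t x < m) at_top"
    using eventually_ge_at_top[of "0::real"]
  proof eventually_elim
    case (elim t)
    then show ?case using F_le_1[of t x] x \<open>1 < m\<close> by simp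
  qed
qed

lemma rate_decay_F:
  assumes x: "0 \<le> x" "x < 1"
  shows "rate_decay \<nu> \<Lambda> \<Lambda>' \<delta> (\<lambda>t. 1 - F t x)"
proof unfold_locales
  fix t :: real assume t: "0 < t"
  show range: "1 - F t x \<in> {0<..1}" using F_less_1[of t x] F_nonneg[of t x] t x by simp
  have "DERIV (\<lambda>t. 1 - F t x) t :> 0 - f (F t x)"
    by (intro DERIV_diff F_time_deriv_at t x DERIV_const)
  then show "DERIV (\<lambda>t. 1 - F t x) t :> - ((1 - F t x) * \<Lambda> (1 - F t x))"
    using range by (simp add: f_rate)
next
  show "((\<lambda>t. 1 - F t x) \<longlongrightarrow> 0) at_top"
    using tendsto_diff[OF tendsto_const[of 1] F_tendsto_1[OF x]] by simp
qed

text \<open>From \<open>x \<le> F t x\<close> the quotient \<open>(1 - F t x) / (1 - x)\<close> is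
  at most 1; its finite partial sums are polynomials in \<open>x\<close>, in which \<open>x\<close>
  may tend to 1. This inequality suffices later, as the Q-process provides mass 1 from the other
  side.\<close>

lemma mean_le_1:
  assumes t: "0 \<le> t"
  shows "summable (\<lambda>j. real j * p t j)" "(\<Sum>j. real j * p t j) \<le> 1"
proof -
  have partial: "(\<Sum>j<J. real j * p t j) \<le> 1" for J
  proof (rule tendsto_upperbound)
    have "((\<lambda>x. \<Sum>j<J. (\<Sum>k<j. x ^ k) * p t j) \<longlongrightarrow> (\<Sum>j<J. (\<Sum>k<j. 1 ^ k) * p t j)) (at_left (1::real))"
      by (intro tendsto_intros)
    then show "((\<lambda>x. \<Sum>j<J. (\<Sum>k<j. x ^ k) * p t j) \<longlongrightarrow> (\<Sum>j<J. real j * p t j)) (at_left (1::real))"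
      by simp
    have "(\<Sum>j<J. (\<Sum>k<j. x ^ k) * p t j) \<le> 1" if x: "0 < x" "x < 1" for x
    proof -
      have sums: "(\<lambda>j. p t j - p t j * x ^ j) sums (1 - F t x)"
        using x by (intro sums_diff p_sums_1[OF t] F_sums[OF t]) auto
      have nonneg: "0 \<le> p t j - p t j * x ^ j" for j
        using p_nonneg[of t j] x by (simp add: mult_left_le power_le_one)
      have "(1 - x) * (\<Sum>j<J. (\<Sum>k<j. x ^ k) * p t j) = (\<Sum>j<J. p t j - p t j * x ^ j)"
        unfolding sum_distrib_left
      proof (intro sum.cong refl)
        fix j
        have "(1 - x) * ((\<Sum>k<j. x ^ k) * p t j) = (1 - x ^ j) * p t j"
          by (simp only: one_diff_power_eq mult.assoc)
        also have "\<dots> = p t j - p t j * x ^ j" by (simp add: algebra_simps)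
        finally show "(1 - x) * ((\<Sum>k<j. x ^ k) * p t j) = p t j - p t j * x ^ j" .
      qed
      also have "\<dots> \<le> 1 - F t x"
        using sum_le_suminf[of "\<lambda>j. p t j - p t j * x ^ j" "{..<J}"] sums nonneg by (simp add: sums_iff)
      also have "\<dots> \<le> (1 - x) * 1" using F_ge[of t x] t x by simp
      finally show ?thesis using x by simp
    qed
    then show "eventually (\<lambda>x. (\<Sum>j<J. (\<Sum>k<j. x ^ k) * p t j) \<le> 1) (at_left (1::real))"
      by (auto simp: eventually_at_left_field intro!: exI[of _ 0])
  qed simp
  show s: "summable (\<lambda>j. real j * p t j)"
    by (rule summableI_nonneg_bounded[OF _ partial]) (simp add: p_nonneg)
  show "(\<Sum>j. real j * p t j) \<le> 1" by (rule suminf_le_const[OF s partial])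
qed

end

subsection \<open>Extinction and the Q-process\<close>

text \<open>The derivative of \<open>ln R\<close> is \<open>- \<Lambda>(R)\<close>, which tends to
  0, so a fixed time shift changes \<open>ln R\<close> by a vanishing amount.\<close>

lemma (in rate_decay) shift_ratio:
  assumes t: "0 \<le> t"
  shows "((\<lambda>u. R u / R (t + u)) \<longlongrightarrow> 1) at_top"
proof (cases "t = 0")
  case True
  have "eventually (\<lambda>u. R u / R (t + u) = 1) at_top"
    using eventually_gt_at_top[of 0] by eventually_elim (use R_range True in force)
  then show ?thesis by (rule tendsto_eventually)
next
  case False
  have ex: "\<exists>\<xi>. u \<le> \<xi> \<and> R u / R (t + u) = exp (t * \<Lambda> (R \<xi>))" if u: "0 < u" for u
  proof -
    have "DERIV (\<lambda>u. ln (R u)) x :> - \<Lambda> (R x)" if "u \<le> x" for x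
    proof -
      have x: "0 < x" using that u by simp
      have "DERIV (\<lambda>u. ln (R u)) x :> 1 / R x * - (R x * \<Lambda> (R x))"
        using R_range[OF x] by (intro DERIV_chain2[OF DERIV_ln_divide R_deriv[OF x]]) auto
      then show ?thesis using R_range[OF x] by simp
    qed
    then obtain \<xi> where "u < \<xi>" "ln (R (t + u)) - ln (R u) = (t + u - u) * - \<Lambda> (R \<xi>)"
      using MVT2[of u "t + u" "\<lambda>u. ln (R u)" "\<lambda>x. - \<Lambda> (R x)"] t False by auto
    moreover have "0 < R u" "0 < R (t + u)" using R_range[of u] R_range[of "t + u"] u t by auto
    ultimately have "u \<le> \<xi>" "ln (R u / R (t + u)) = t * \<Lambda> (R \<xi>)" by (auto simp: ln_divide_pos)
    then show ?thesis using \<open>0 < R u\<close> \<open>0 < R (t + u)\<close>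
      by (intro exI[of _ \<xi>]) (metis divide_pos_pos exp_ln)
  qed
  then obtain \<xi> where \<xi>: "\<And>u. 0 < u \<Longrightarrow> u \<le> \<xi> u \<and> R u / R (t + u) = exp (t * \<Lambda> (R (\<xi> u)))"
    by metis
  have "filterlim \<xi> at_top at_top"
    by (rule filterlim_at_top_mono[OF filterlim_ident])
       (use eventually_gt_at_top[of "0::real"] in \<open>eventually_elim, use \<xi> in auto\<close>)
  then have "((\<lambda>u. \<Lambda> (R (\<xi> u))) \<longlongrightarrow> 0) at_top"
    by (intro filterlim_compose[OF rate_tendsto_0] filterlim_compose[OF R_at_right_0])
  then have "((\<lambda>u. exp (t * \<Lambda> (R (\<xi> u)))) \<longlongrightarrow> exp (t * 0)) at_top"
    by (intro tendsto_intros)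
  then have lim: "((\<lambda>u. exp (t * \<Lambda> (R (\<xi> u)))) \<longlongrightarrow> 1) at_top" by simp
  show ?thesis
    by (rule Lim_transform_eventually[OF lim])
       (use eventually_gt_at_top[of "0::real"] in \<open>eventually_elim, use \<xi> in auto\<close>)
qed

section \<open>Measurability and law of the extinction time\<close>

context markov_branching_process
begin

text \<open>The zeroth convolution power is the unit mass at 0, so no mass moves from 0 to a
  positive state.\<close>

lemma absorbing_0:
  assumes i: "i \<in> insert 0 S" and q: "0 \<le> q" "q \<le> v"
  shows "AE \<omega> in M i. Z q \<omega> = 0 \<longrightarrow> Z v \<omega> = 0"
proof -
  interpret prob_space "M i" using prob_spaces i by blast
  have [measurable]: "Z q \<in> M i \<rightarrow>\<^sub>M count_space UNIV" "Z v \<in> M i \<rightarrow>\<^sub>M count_space UNIV"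
    using random_variables i q by auto
  have "AE \<omega> in M i. \<not> (Z q \<omega> = 0 \<and> Z v \<omega> = k)" if "k \<noteq> 0" for k
  proof -
    have "trans_prob M Z (v - q) 0 k = 0"
      using trans_prob_eq_coeff[of 0 "v - q" k] q that by simp
    then have "\<P>(\<omega> in M i. Z q \<omega> = 0 \<and> Z v \<omega> = k) = 0"
      using joint_prob[OF i, of q "v - q" 0 k] q by simp
    then show ?thesis by (subst (asm) prob_Collect_eq_0) auto
  qed
  then have "AE \<omega> in M i. \<forall>k. k \<noteq> 0 \<longrightarrow> \<not> (Z q \<omega> = 0 \<and> Z v \<omega> = k)"
    by (subst AE_all_countable) auto
  then show ?thesis by eventually_elim auto
qed

lemma right_constant:
  assumes i: "i \<in> insert 0 S" and \<omega>: "\<omega> \<in> space (M i)" and t: "0 \<le> t"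
  obtains b where "t < b" "\<And>r. t < r \<Longrightarrow> r < b \<Longrightarrow> Z r \<omega> = Z t \<omega>"
proof -
  have "eventually (\<lambda>r. Z r \<omega> = Z t \<omega>) (at_right t)"
    using right_continuous_paths[OF i \<omega> t] by (simp add: tendsto_discrete_iff)
  then obtain b where "t < b" "\<forall>r>t. r < b \<longrightarrow> Z r \<omega> = Z t \<omega>"
    unfolding eventually_at_right_field by blast
  then show ?thesis by (intro that[of b]) auto
qed

text \<open>By right-continuity a zero before \<open>v\<close> persists up to some rational time
  before \<open>v\<close>, and a nonzero value at \<open>v\<close> persists beyond \<open>v\<close>.
  Countably many times thus decide the event.\<close>

lemma extinction_time_le_iff:
  assumes i: "i \<in> insert 0 S" and \<omega>: "\<omega> \<in> space (M i)" and v: "0 \<le> v"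
  shows "extinction_time Z \<omega> \<le> ereal v \<longleftrightarrow>
    Z v \<omega> = 0 \<or> (\<exists>q\<in>\<rat>. 0 \<le> q \<and> q < v \<and> Z q \<omega> = 0)"
proof
  assume H: "extinction_time Z \<omega> \<le> ereal v"
  show "Z v \<omega> = 0 \<or> (\<exists>q\<in>\<rat>. 0 \<le> q \<and> q < v \<and> Z q \<omega> = 0)"
  proof (rule ccontr)
    assume contra: "\<not> ?thesis"
    obtain b where b: "v < b" "\<And>r. v < r \<Longrightarrow> r < b \<Longrightarrow> Z r \<omega> = Z v \<omega>"
      using right_constant[OF i \<omega> v] by blast
    have "b \<le> t" if t: "0 \<le> t" "Z t \<omega> = 0" for t
    proof (rule ccontr)
      assume tb: "\<not> b \<le> t"
      have "t < v"
        using b(2)[of t] contra t tb by (metis linorder_cases not_less)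
      obtain c where c: "t < c" "\<And>r. t < r \<Longrightarrow> r < c \<Longrightarrow> Z r \<omega> = Z t \<omega>"
        using right_constant[OF i \<omega> t(1)] by blast
      obtain q where "q \<in> \<rat>" "t < q" "q < min c v"
        using Rats_dense_in_real[of t "min c v"] c(1) \<open>t < v\<close> by auto
      then show False using contra c(2)[of q] t by auto
    qed
    then have "ereal b \<le> extinction_time Z \<omega>"
      unfolding extinction_time_def by (intro Inf_greatest) auto
    then show False using H b(1) by (metis ereal_less_eq(3) not_less order_trans)
  qed
next
  have H: "extinction_time Z \<omega> \<le> ereal t" if "0 \<le> t" "Z t \<omega> = 0" for t
    unfolding extinction_time_def using that by (intro Inf_lower) auto
  assume "Z v \<omega> = 0 \<or> (\<exists>q\<in>\<rat>. 0 \<le> q \<and> q < v \<and> Z q \<omega> = 0)"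
  then show "extinction_time Z \<omega> \<le> ereal v"
  proof
    assume "\<exists>q\<in>\<rat>. 0 \<le> q \<and> q < v \<and> Z q \<omega> = 0"
    then obtain q where "0 \<le> q" "q < v" "Z q \<omega> = 0" by blast
    then show ?thesis using H[of q] by (meson ereal_less_eq(3) less_imp_le order_trans)
  qed (use H v in auto)
qed

lemma less_extinction_time_iff:
  assumes i: "i \<in> insert 0 S" and \<omega>: "\<omega> \<in> space (M i)" and v: "0 \<le> v"
  shows "ereal v < extinction_time Z \<omega> \<longleftrightarrow> Z v \<omega> \<noteq> 0 \<and> (\<forall>q\<in>\<rat> \<inter> {0..<v}. Z q \<omega> \<noteq> 0)"
  by (subst not_le[symmetric], subst extinction_time_le_iff[OF assms]) auto

lemma extinction_time_measurable:
  assumes i: "i \<in> insert 0 S" and v: "0 \<le> v"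
  shows "{\<omega>\<in>space (M i). ereal v < extinction_time Z \<omega>} \<in> sets (M i)"
proof -
  have "{\<omega>\<in>space (M i). ereal v < extinction_time Z \<omega>} =
      {\<omega>\<in>space (M i). Z v \<omega> \<noteq> 0} - (\<Union>q\<in>\<rat> \<inter> {0..<v}. {\<omega>\<in>space (M i). Z q \<omega> = 0})"
  proof -
    have "{\<omega>\<in>space (M i). ereal v < extinction_time Z \<omega>} =
        {\<omega>\<in>space (M i). Z v \<omega> \<noteq> 0 \<and> (\<forall>q\<in>\<rat> \<inter> {0..<v}. Z q \<omega> \<noteq> 0)}"
      by (intro Collect_cong conj_cong refl less_extinction_time_iff[OF i _ v])
    also have "\<dots> = {\<omega>\<in>space (M i). Z v \<omega> \<noteq> 0} - (\<Union>q\<in>\<rat> \<inter> {0..<v}. {\<omega>\<in>space (M i). Z q \<omega> = 0})"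
      by (intro set_eqI) (simp, metis)
    finally show ?thesis .
  qed
  moreover have "(\<Union>q\<in>\<rat> \<inter> {0..<v}. {\<omega>\<in>space (M i). Z q \<omega> = 0}) \<in> sets (M i)"
  proof (rule sets.countable_UN'')
    show "countable (\<rat> \<inter> {0..<v})" using countable_rat by (rule countable_subset[rotated]) auto
    show "{\<omega>\<in>space (M i). Z q \<omega> = 0} \<in> sets (M i)" if "q \<in> \<rat> \<inter> {0..<v}" for q
    proof -
      have [measurable]: "Z q \<in> M i \<rightarrow>\<^sub>M count_space UNIV" using random_variables i that by auto
      show ?thesis by measurable
    qed
  qed
  moreover have "{\<omega>\<in>space (M i). Z v \<omega> \<noteq> 0} \<in> sets (M i)"
  proof -
    have [measurable]: "Z v \<in> M i \<rightarrow>\<^sub>M count_space UNIV" using random_variables i v by auto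
    show ?thesis by measurable
  qed
  ultimately show ?thesis by auto
qed

text \<open>Absorption holds almost surely for each pair of times; only the countably many rational
  times before \<open>v\<close> are needed simultaneously.\<close>

lemma AE_extinction_time:
  assumes i: "i \<in> insert 0 S" and v: "0 \<le> v"
  shows "AE \<omega> in M i. ereal v < extinction_time Z \<omega> \<longleftrightarrow> Z v \<omega> \<noteq> 0"
proof -
  have "AE \<omega> in M i. \<forall>q\<in>\<rat> \<inter> {0..<v}. Z q \<omega> = 0 \<longrightarrow> Z v \<omega> = 0"
  proof (subst AE_ball_countable)
    show "countable (\<rat> \<inter> {0..<v})" using countable_rat by (rule countable_subset[rotated]) auto
    show "\<forall>q\<in>\<rat> \<inter> {0..<v}. AE \<omega> in M i. Z q \<omega> = 0 \<longrightarrow> Z v \<omega> = 0"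
      using absorbing_0[OF i] by auto
  qed
  then show ?thesis
    using AE_space[of "M i"]
  proof eventually_elim
    case (elim \<omega>)
    show ?case unfolding less_extinction_time_iff[OF i elim(2) v] using elim(1) by metis
  qed
qed

lemma prob_survival:
  assumes i: "i \<in> insert 0 S" and v: "0 \<le> v"
  shows "\<P>(\<omega> in M i. ereal v < extinction_time Z \<omega>) = 1 - F v 0 ^ i"
proof -
  interpret prob_space "M i" using prob_spaces i by blast
  have [measurable]: "Z v \<in> M i \<rightarrow>\<^sub>M count_space UNIV" using random_variables i v by auto
  have "\<P>(\<omega> in M i. ereal v < extinction_time Z \<omega>) = \<P>(\<omega> in M i. \<not> Z v \<omega> = 0)"
    using AE_extinction_time[OF i v] extinction_time_measurable[OF i v] by (intro prob_eq_AE) auto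
  also have "\<dots> = 1 - trans_prob M Z v i 0"
    unfolding trans_prob_def by (rule prob_neg) measurable
  finally show ?thesis
    using trans_prob_eq_coeff[OF i v, of 0] by (simp add: fps_power_zeroth F_at_0)
qed

end

section \<open>Conditioning on late extinction\<close>

context critical_branching
begin

text \<open>Survival forever is at most as likely as survival to time \<open>v\<close>, whose
  probability tends to 0 because \<open>F v 0\<close> tends to 1.\<close>

lemma AE_extinction:
  assumes i: "i \<in> insert 0 S"
  shows "AE \<omega> in M i. extinction_time Z \<omega> < \<infinity>"
    and "{\<omega>\<in>space (M i). extinction_time Z \<omega> < \<infinity>} \<in> sets (M i)"
proof -
  interpret prob_space "M i" using prob_spaces i by blast
  have iff: "extinction_time Z \<omega> = \<infinity> \<longleftrightarrow> (\<forall>n::nat. ereal (real n) < extinction_time Z \<omega>)" for \<omega>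
    using less_PInf_Ex_of_nat[of "extinction_time Z \<omega>"]
    by (cases "extinction_time Z \<omega> = \<infinity>") (auto dest: less_asym)
  have "{\<omega>\<in>space (M i). extinction_time Z \<omega> = \<infinity>} =
      (\<Inter>n::nat. {\<omega>\<in>space (M i). ereal (real n) < extinction_time Z \<omega>})"
    by (auto simp: iff)
  moreover have "(\<Inter>n::nat. {\<omega>\<in>space (M i). ereal (real n) < extinction_time Z \<omega>}) \<in> events"
    using extinction_time_measurable[OF i] by (intro sets.countable_INT) auto
  ultimately have inf: "{\<omega>\<in>space (M i). extinction_time Z \<omega> = \<infinity>} \<in> events" by simp
  have "{\<omega>\<in>space (M i). extinction_time Z \<omega> < \<infinity>} =
      space (M i) - {\<omega>\<in>space (M i). extinction_time Z \<omega> = \<infinity>}" by auto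
  then show "{\<omega>\<in>space (M i). extinction_time Z \<omega> < \<infinity>} \<in> events" using inf by auto
  have le: "\<P>(\<omega> in M i. extinction_time Z \<omega> = \<infinity>) \<le> 1 - F v 0 ^ i" if "0 \<le> v" for v
    unfolding prob_survival[OF i that, symmetric]
    using extinction_time_measurable[OF i that] by (intro finite_measure_mono) auto
  have "((\<lambda>v. 1 - F v 0 ^ i) \<longlongrightarrow> 1 - 1 ^ i) at_top"
    by (intro tendsto_intros F_tendsto_1) auto
  then have lim: "((\<lambda>v. 1 - F v 0 ^ i) \<longlongrightarrow> 0) at_top" by simp
  have "\<P>(\<omega> in M i. extinction_time Z \<omega> = \<infinity>) \<le> 0"
    by (rule tendsto_lowerbound[OF lim])
       (use eventually_mono[OF eventually_ge_at_top[of "0::real"] le] in auto)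
  then have "\<P>(\<omega> in M i. extinction_time Z \<omega> = \<infinity>) = 0" by (simp add: measure_le_0_iff)
  then have "AE \<omega> in M i. \<not> extinction_time Z \<omega> = \<infinity>" using prob_Collect_eq_0[OF inf] by simp
  then show "AE \<omega> in M i. extinction_time Z \<omega> < \<infinity>" by eventually_elim auto
qed

lemma conditional_prob:
  assumes i: "i \<in> insert 0 S" and t: "0 \<le> t" and u: "0 \<le> u"
  shows "\<P>(\<omega> in M i. Z t \<omega> = j \<bar> ereal (t + u) < extinction_time Z \<omega> \<and> extinction_time Z \<omega> < \<infinity>) =
    trans_prob M Z t i j * (1 - F u 0 ^ j) / (1 - F (t + u) 0 ^ i)"
proof -
  interpret prob_space "M i" using prob_spaces i by blast
  have [measurable]: "Z t \<in> M i \<rightarrow>\<^sub>M count_space UNIV" "Z (t + u) \<in> M i \<rightarrow>\<^sub>M count_space UNIV"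
    using random_variables i t u by auto
  have [measurable]: "{\<omega>\<in>space (M i). ereal (t + u) < extinction_time Z \<omega>} \<in> events"
    "{\<omega>\<in>space (M i). extinction_time Z \<omega> < \<infinity>} \<in> events"
    using extinction_time_measurable[OF i, of "t + u"] AE_extinction(2)[OF i] t u by auto
  have AE: "AE \<omega> in M i. (ereal (t + u) < extinction_time Z \<omega> \<and> extinction_time Z \<omega> < \<infinity>) \<longleftrightarrow> Z (t + u) \<omega> \<noteq> 0"
    using AE_extinction(1)[OF i] AE_extinction_time[OF i add_nonneg_nonneg[OF t u]]
    by eventually_elim auto
  have "\<P>(\<omega> in M i. Z t \<omega> = j \<and> ereal (t + u) < extinction_time Z \<omega> \<and> extinction_time Z \<omega> < \<infinity>) =
      \<P>(\<omega> in M i. Z t \<omega> = j \<and> \<not> Z (t + u) \<omega> = 0)"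
  proof (rule prob_eq_AE)
    show "AE \<omega> in M i. (Z t \<omega> = j \<and> ereal (t + u) < extinction_time Z \<omega> \<and> extinction_time Z \<omega> < \<infinity>) \<longleftrightarrow>
        (Z t \<omega> = j \<and> \<not> Z (t + u) \<omega> = 0)"
      using AE by eventually_elim auto
    show "{\<omega>\<in>space (M i). Z t \<omega> = j \<and> ereal (t + u) < extinction_time Z \<omega> \<and> extinction_time Z \<omega> < \<infinity>} \<in> events"
      by (intro sets.sets_Collect_conj) measurable
  qed measurable
  also have "\<dots> = trans_prob M Z t i j - \<P>(\<omega> in M i. Z t \<omega> = j \<and> Z (t + u) \<omega> = 0)"
  proof -
    have "{\<omega>\<in>space (M i). Z t \<omega> = j \<and> \<not> Z (t + u) \<omega> = 0} =
        {\<omega>\<in>space (M i). Z t \<omega> = j} - {\<omega>\<in>space (M i). Z t \<omega> = j \<and> Z (t + u) \<omega> = 0}" by auto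
    then show ?thesis unfolding trans_prob_def
      by (simp only:) (rule finite_measure_Diff; auto)
  qed
  also have "\<dots> = trans_prob M Z t i j * (1 - F u 0 ^ j)"
  proof (cases "j \<in> insert 0 S")
    case True
    then show ?thesis
      using joint_prob[OF i t u, of j 0] trans_prob_eq_coeff[OF True u, of 0]
      by (simp add: fps_power_zeroth F_at_0 right_diff_distrib)
  next
    case False
    then show ?thesis using joint_prob[OF i t u, of j 0] trans_prob_outside[OF i t False] by simp
  qed
  finally have num: "\<P>(\<omega> in M i. Z t \<omega> = j \<and> ereal (t + u) < extinction_time Z \<omega> \<and> extinction_time Z \<omega> < \<infinity>) =
    trans_prob M Z t i j * (1 - F u 0 ^ j)" .
  have "\<P>(\<omega> in M i. ereal (t + u) < extinction_time Z \<omega> \<and> extinction_time Z \<omega> < \<infinity>) =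
      \<P>(\<omega> in M i. ereal (t + u) < extinction_time Z \<omega>)"
  proof (rule prob_eq_AE)
    show "AE \<omega> in M i. (ereal (t + u) < extinction_time Z \<omega> \<and> extinction_time Z \<omega> < \<infinity>) \<longleftrightarrow>
        ereal (t + u) < extinction_time Z \<omega>"
      using AE_extinction(1)[OF i] by eventually_elim auto
    show "{\<omega>\<in>space (M i). ereal (t + u) < extinction_time Z \<omega> \<and> extinction_time Z \<omega> < \<infinity>} \<in> events"
      by (intro sets.sets_Collect_conj) measurable
  qed measurable
  also have "\<dots> = 1 - F (t + u) 0 ^ i" using prob_survival[OF i, of "t + u"] t u by simp
  finally show ?thesis unfolding cond_prob_def num by simp
qed

text \<open>Factoring \<open>1 - y ^ j\<close> as \<open>(1 - y)\<close> times a geometric sum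
  splits the conditional probability: the factors \<open>1 - y\<close> have ratio tending to 1 by
  \<open>shift_ratio\<close>, and the geometric sums tend to \<open>j\<close> and
  \<open>i\<close>.\<close>

lemma Q_trans_prob_eq:
  assumes i: "i \<in> S" and t: "0 \<le> t"
  shows "Q_trans_prob M Z t i j = real j / real i * trans_prob M Z t i j"
proof -
  have i': "i \<in> insert 0 S" and i0: "i \<noteq> 0" using i zero_notin_S by (blast, metis)
  interpret R: rate_decay \<nu> \<Lambda> \<Lambda>' \<delta> "\<lambda>t. 1 - F t 0" by (rule rate_decay_F) auto
  define h where "h u = trans_prob M Z t i j *
    ((1 - F u 0) / (1 - F (t + u) 0) * (\<Sum>k<j. F u 0 ^ k) / (\<Sum>k<i. F (t + u) 0 ^ k))" for u
  have shift: "((\<lambda>u. F (t + u) 0) \<longlongrightarrow> 1) at_top"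
    by (rule filterlim_compose[OF F_tendsto_1]) (auto intro: filterlim_tendsto_add_at_top[OF tendsto_const filterlim_ident])
  have "(h \<longlongrightarrow> trans_prob M Z t i j * (1 * (\<Sum>k<j. 1 ^ k) / (\<Sum>k<i. 1 ^ k))) at_top"
    unfolding h_def
    by (intro tendsto_intros R.shift_ratio[OF t] F_tendsto_1 shift) (use i0 in auto)
  then have lim: "(h \<longlongrightarrow> real j / real i * trans_prob M Z t i j) at_top" by (simp add: mult.commute)
  have "((\<lambda>u. \<P>(\<omega> in M i. Z t \<omega> = j \<bar> ereal (t + u) < extinction_time Z \<omega> \<and> extinction_time Z \<omega> < \<infinity>))
    \<longlongrightarrow> real j / real i * trans_prob M Z t i j) at_top"
  proof (rule Lim_transform_eventually[OF lim])
    show "eventually (\<lambda>u. h u = \<P>(\<omega> in M i. Z t \<omega> = j \<bar> ereal (t + u) < extinction_time Z \<omega> \<and> extinction_time Z \<omega> < \<infinity>)) at_top"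
      using eventually_ge_at_top[of "0::real"]
    proof eventually_elim
      case (elim u)
      show ?case unfolding conditional_prob[OF i' t elim] h_def by (simp add: one_diff_power_eq)
    qed
  qed
  then show ?thesis unfolding Q_trans_prob_def by (intro tendsto_Lim) auto
qed

end

subsection \<open>The invariant measure\<close>

text \<open>The identity is available only on \<open>(0, 1)\<close>: once the lower coefficients
  vanish, dividing by \<open>x ^ n\<close> and letting \<open>x\<close> decrease to 0 isolates the
  next one.\<close>

lemma power_series_eq_0:
  fixes c :: "nat \<Rightarrow> real"
  assumes sums: "\<And>x. 0 < x \<Longrightarrow> x < 1 \<Longrightarrow> (\<lambda>j. c j * x ^ j) sums 0"
  shows "c n = 0"
proof (induction n rule: less_induct)
  case (less n)
  have tail: "(\<lambda>j. c (j + n) * x ^ j) sums 0" if x: "0 < x" "x < 1" for x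
  proof -
    have "(\<lambda>j. c (j + n) * x ^ (j + n)) sums (0 - (\<Sum>j<n. c j * x ^ j))"
      using sums[OF x] by (rule sums_split_initial_segment)
    also have "(\<Sum>j<n. c j * x ^ j) = 0" using less by (intro sum.neutral) auto
    finally have "(\<lambda>j. c (j + n) * x ^ (j + n) / x ^ n) sums ((0 - 0) / x ^ n)"
      by (rule sums_divide)
    then show ?thesis using x by (simp add: power_add)
  qed
  define g where "g x = (\<Sum>j. c (j + n) * x ^ j)" for x
  have "summable (\<lambda>j. c (j + n) * x ^ j)" if "norm x < 1" for x
    by (rule powser_inside[where x = "(1 + \<bar>x\<bar>) / 2"])
       (use that tail[of "(1 + \<bar>x\<bar>) / 2"] in \<open>auto simp: sums_iff\<close>)
  then have "(g \<longlongrightarrow> c (0 + n)) (at 0)"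
    unfolding g_def by (intro powser_limit_0[of 1]) (auto intro: summable_sums)
  then have "(g \<longlongrightarrow> c n) (at_right 0)" by (simp add: filterlim_at_split)
  moreover have "eventually (\<lambda>x. g x = 0) (at_right 0)"
    using tail by (auto simp: eventually_at_right_field g_def sums_iff intro!: exI[of _ 1])
  then have "(g \<longlongrightarrow> 0) (at_right 0)" by (rule tendsto_eventually)
  ultimately show ?case by (intro tendsto_unique[OF trivial_limit_at_right_real])
qed

lemma power_series_unique:
  fixes c d :: "nat \<Rightarrow> real"
  assumes "\<And>x. 0 < x \<Longrightarrow> x < 1 \<Longrightarrow> (\<lambda>j. c j * x ^ j) sums g x"
    and "\<And>x. 0 < x \<Longrightarrow> x < 1 \<Longrightarrow> (\<lambda>j. d j * x ^ j) sums g x"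
  shows "c n = d n"
proof -
  have "(\<lambda>j. (c j - d j) * x ^ j) sums 0" if "0 < x" "x < 1" for x
    using sums_diff[OF assms[OF that]] by (simp add: left_diff_distrib)
  then have "c n - d n = 0" by (rule power_series_eq_0)
  then show ?thesis by simp
qed

lemma sums_index_mult:
  fixes c :: "nat \<Rightarrow> real"
  assumes "(\<lambda>n. diffs c n * x ^ n) sums d"
  shows "(\<lambda>j. real j * c j * x ^ j) sums (x * d)"
proof -
  have "(\<lambda>n. x * (diffs c n * x ^ n)) sums (x * d)" by (rule sums_mult[OF assms])
  then have "(\<lambda>n. real (Suc n) * c (Suc n) * x ^ Suc n) sums (x * d)"
    by (simp add: diffs_def mult_ac)
  then show ?thesis using sums_Suc_iff[of "\<lambda>j. real j * c j * x ^ j" "x * d"] by simp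
qed

text \<open>
  Factoring \<open>g x = (1 - x) D x\<close>, where the coefficients of \<open>D\<close> are the partial sums of those of
  \<open>g\<close>, the reciprocal \<open>1 / D\<close> is a renewal series and so has nonnegative coefficients.
\<close>

lemma reciprocal_power_series:
  fixes b :: "nat \<Rightarrow> real" and g :: "real \<Rightarrow> real"
  assumes b0: "0 < b 0" and partial: "\<And>n. 0 < n \<Longrightarrow> (\<Sum>i\<le>n. b i) \<le> 0"
    and sums: "\<And>x. 0 \<le> x \<Longrightarrow> x < 1 \<Longrightarrow> (\<lambda>j. b j * x ^ j) sums g x"
    and abs: "\<And>x. 0 \<le> x \<Longrightarrow> x < 1 \<Longrightarrow> summable (\<lambda>j. \<bar>b j * x ^ j\<bar>)"
    and pos: "\<And>x. 0 \<le> x \<Longrightarrow> x < 1 \<Longrightarrow> 0 < g x"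
  obtains c where "\<And>n. 0 < c n" "\<And>x. 0 \<le> x \<Longrightarrow> x < 1 \<Longrightarrow> (\<lambda>n. c n * x ^ n) sums (1 / g x)"
proof -
  define ones :: "real fps" where "ones = Abs_fps (\<lambda>_. 1)"
  define D where "D = Abs_fps b * ones"
  define e where "e = inverse D"
  have ones_sums: "(\<lambda>j. fps_nth ones j * x ^ j) sums (1 / (1 - x))"
    and ones_abs: "summable (\<lambda>j. \<bar>fps_nth ones j * x ^ j\<bar>)" if "0 \<le> x" "x < 1" for x
    using that geometric_sums[of x] summable_geometric[of x] by (auto simp: ones_def)
  have D_nth: "fps_nth D n = (\<Sum>i\<le>n. b i)" for n
    by (simp add: D_def ones_def fps_mult_nth atMost_atLeast0)
  have D0: "fps_nth D 0 = b 0" by (simp add: D_nth)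
  have D_sums: "(\<lambda>j. fps_nth D j * x ^ j) sums (g x / (1 - x))" if "0 \<le> x" "x < 1" for x
    using fps_mult_sums[of "Abs_fps b" x "g x" ones "1 / (1 - x)"] that sums abs ones_sums ones_abs by (simp add: D_def)
  have D_abs: "summable (\<lambda>j. \<bar>fps_nth D j * x ^ j\<bar>)" if x: "0 \<le> x" "x < 1" for x
  proof -
    \<comment> \<open>All coefficients after the first are nonpositive, so the absolute values
      differ from the negated series at index 0 only.\<close>
    have "\<bar>fps_nth D j * x ^ j\<bar> = (if j = 0 then 2 * b 0 else 0) - fps_nth D j * x ^ j" for j
      using partial[of j] b0 x by (cases "j = 0") (auto simp: D_nth abs_mult abs_of_nonpos)
    then show ?thesis
      using summable_diff[OF sums_summable[OF sums_single[of 0 "\<lambda>_. 2 * b 0"]] sums_summable[OF D_sums[OF x]]]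
      by simp
  qed
  have eD: "e * D = 1" unfolding e_def using b0 D0 by (intro inverse_mult_eq_1) auto
  \<comment> \<open>The renewal recursion: \<open>D * e = 1\<close> solved for the newest
    coefficient, with nonnegative weights \<open>- D_i\<close> on the earlier ones.\<close>
  have rec: "b 0 * fps_nth e n = (if n = 0 then 1 else 0) + (\<Sum>i=1..n. - fps_nth D i * fps_nth e (n - i))" for n
  proof -
    have "fps_nth (D * e) n = (if n = 0 then 1 else 0)" using eD by (simp add: mult.commute)
    moreover have "fps_nth (D * e) n = b 0 * fps_nth e n + (\<Sum>i=1..n. fps_nth D i * fps_nth e (n - i))"
      by (simp add: fps_mult_nth sum.atLeast_Suc_atMost D0)
    ultimately show ?thesis by (simp add: sum_negf)
  qed
  have e_nonneg: "0 \<le> fps_nth e n" for n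
  proof (induction n rule: less_induct)
    case (less n)
    have "0 \<le> (\<Sum>i=1..n. - fps_nth D i * fps_nth e (n - i))"
      using partial less by (intro sum_nonneg mult_nonneg_nonneg) (auto simp: D_nth)
    then have "0 \<le> b 0 * fps_nth e n" unfolding rec[of n] by auto
    then show ?case using b0 by (simp add: zero_le_mult_iff)
  qed
  \<comment> \<open>Positivity of \<open>g\<close> makes the weights \<open>- D_i x^i\<close> sum to
    at most \<open>b 0\<close>, so the recursion preserves the bound \<open>1 / b 0\<close>.\<close>
  have e_bound: "fps_nth e n * x ^ n \<le> 1 / b 0" if x: "0 \<le> x" "x < 1" for n x
  proof (induction n rule: less_induct)
    case (less n)
    show ?case
    proof (cases "n = 0")
      case True
      then show ?thesis using rec[of 0] b0 by (simp add: field_simps)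
    next
      case False
      have "(\<Sum>i\<le>n. fps_nth D i * x ^ i) \<ge> g x / (1 - x)"
      proof -
        have "(\<Sum>j. - (fps_nth D j * x ^ j) + (if j = 0 then b 0 else 0)) \<ge>
            (\<Sum>j\<le>n. - (fps_nth D j * x ^ j) + (if j = 0 then b 0 else 0))"
          using partial x b0
          by (intro sum_le_suminf summable_add summable_minus sums_summable[OF D_sums] sums_summable[OF sums_single])
             (auto simp: D_nth mult_nonpos_nonneg)
        moreover have "(\<lambda>j. - (fps_nth D j * x ^ j) + (if j = 0 then b 0 else 0)) sums (- (g x / (1 - x)) + b 0)"
          using sums_add[OF sums_minus[OF D_sums[OF x]] sums_single[of 0 "\<lambda>_. b 0"]] by simp
        ultimately show ?thesis by (simp add: sums_iff sum_subtractf)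
      qed
      then have "0 \<le> (\<Sum>i\<le>n. fps_nth D i * x ^ i)" using pos[OF x] x by (smt (verit) divide_nonneg_pos)
      also have "(\<Sum>i\<le>n. fps_nth D i * x ^ i) = b 0 - (\<Sum>i=1..n. - fps_nth D i * x ^ i)"
        by (simp add: atMost_atLeast0 sum.atLeast_Suc_atMost D0 sum_negf)
      finally have k: "(\<Sum>i=1..n. - fps_nth D i * x ^ i) \<le> b 0" by simp
      have "b 0 * (fps_nth e n * x ^ n) = (\<Sum>i=1..n. - fps_nth D i * fps_nth e (n - i)) * x ^ n"
        using rec[of n] False by (simp add: mult.assoc[symmetric])
      also have "\<dots> = (\<Sum>i=1..n. (- fps_nth D i * x ^ i) * (fps_nth e (n - i) * x ^ (n - i)))"
        unfolding sum_distrib_right by (intro sum.cong refl) (auto simp: power_add[symmetric] mult_ac)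
      also have "\<dots> \<le> (\<Sum>i=1..n. (- fps_nth D i * x ^ i) * (1 / b 0))"
        using partial x by (intro sum_mono mult_left_mono less) (auto simp: D_nth mult_nonpos_nonneg)
      also have "\<dots> = (\<Sum>i=1..n. - fps_nth D i * x ^ i) * (1 / b 0)" by (rule sum_distrib_right[symmetric])
      also have "\<dots> \<le> b 0 * (1 / b 0)" using k b0 by (intro mult_right_mono) auto
      finally show ?thesis using b0 by (simp add: pos_le_divide_eq mult.commute)
    qed
  qed
  have e_summable: "summable (\<lambda>n. \<bar>fps_nth e n * x ^ n\<bar>)" if x: "0 \<le> x" "x < 1" for x
  proof -
    \<comment> \<open>The bound at the larger point \<open>y\<close> yields a geometric majorant of
      ratio \<open>x / y\<close> at \<open>x\<close>.\<close>
    define y where "y = (1 + x) / 2"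
    have y: "0 < y" "y < 1" "x < y" using x by (auto simp: y_def)
    have "summable (\<lambda>n. 1 / b 0 * (x / y) ^ n)" using x y by (intro summable_mult summable_geometric) auto
    then show ?thesis
    proof (rule summable_comparison_test'[where N = 0])
      fix n
      have "fps_nth e n * x ^ n = fps_nth e n * y ^ n * (x / y) ^ n" using y by (simp add: power_divide)
      also have "\<dots> \<le> 1 / b 0 * (x / y) ^ n" using e_bound[of y n] x y by (intro mult_right_mono) auto
      finally show "norm \<bar>fps_nth e n * x ^ n\<bar> \<le> 1 / b 0 * (x / y) ^ n" using e_nonneg[of n] x by simp
    qed
  qed
  have e_sums: "(\<lambda>n. fps_nth e n * x ^ n) sums ((1 - x) / g x)" if x: "0 \<le> x" "x < 1" for x
  proof -
    obtain s where s: "(\<lambda>n. fps_nth e n * x ^ n) sums s"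
      using summable_rabs_cancel[OF e_summable[OF x]] by (auto simp: summable_def)
    have "(\<lambda>n. fps_nth (e * D) n * x ^ n) sums (s * (g x / (1 - x)))"
      by (intro fps_mult_sums s D_sums D_abs e_summable x)
    moreover have "(\<lambda>n. fps_nth (e * D) n * x ^ n) sums 1"
      using sums_single[of 0 "\<lambda>_. 1::real"] by (rule sums_cong[THEN iffD1, rotated]) (simp add: eD)
    ultimately have "s * (g x / (1 - x)) = 1" by (rule sums_unique2)
    then have "s = (1 - x) / g x" using pos[OF x] x by (simp add: field_simps)
    with s show ?thesis by simp
  qed
  show ?thesis
  \<comment> \<open>Multiplying by \<open>ones\<close> undoes the factor \<open>1 - x\<close> and
    forms partial sums of \<open>e\<close>, which are positive because the first coefficient
    is.\<close>
  proof (rule that[of "fps_nth (e * ones)"])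
    fix n
    have "0 < fps_nth e 0" using rec[of 0] b0 by (simp add: zero_less_mult_iff mult_pos_pos) (metis zero_less_mult_pos zero_less_one)
    then show "0 < fps_nth (e * ones) n"
      using e_nonneg by (auto simp: fps_mult_nth ones_def intro!: sum_pos2[of _ 0])
  next
    fix x :: real assume x: "0 \<le> x" "x < 1"
    have "(\<lambda>n. fps_nth (e * ones) n * x ^ n) sums ((1 - x) / g x * (1 / (1 - x)))"
      by (intro fps_mult_sums e_sums ones_sums ones_abs e_summable x)
    then show "(\<lambda>n. fps_nth (e * ones) n * x ^ n) sums (1 / g x)" using x by simp
  qed
qed

section \<open>Reachability of states\<close>

lemma fps_power_nth_pos:
  fixes P :: "real fps"
  assumes nonneg: "\<And>j. 0 \<le> fps_nth P j" and "0 < fps_nth P 0" "0 < fps_nth P 1" and "j \<le> m"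
  shows "0 < fps_nth (P ^ m) j"
  using \<open>j \<le> m\<close>
proof (induction m arbitrary: j)
  case (Suc m)
  have *: "0 \<le> fps_nth P i * fps_nth (P ^ m) (j - i)" for i
    using nonneg fps_power_nonneg[of P, OF nonneg] by simp
  \<comment> \<open>The new factor contributes exponent 0 as long as \<open>j \<le> m\<close>, and
    exponent 1 in the only other case \<open>j = Suc m\<close>.\<close>
  have "\<exists>i\<in>{0..j}. 0 < fps_nth P i * fps_nth (P ^ m) (j - i)"
  proof (cases "j \<le> m")
    case True
    then show ?thesis using Suc.IH[of j] assms by (intro bexI[of _ 0]) auto
  next
    case False
    then show ?thesis using Suc.IH[of "j - 1"] Suc.prems assms by (intro bexI[of _ 1]) auto
  qed
  then show ?case using * by (auto simp: fps_mult_nth intro: sum_pos2)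
qed simp

lemma fps_power_nth_mult_pos:
  fixes P :: "real fps"
  assumes nonneg: "\<And>j. 0 \<le> fps_nth P j" and "0 < fps_nth P m"
  shows "0 < fps_nth (P ^ k) (k * m)"
proof (induction k)
  case (Suc k)
  have "0 < fps_nth P m * fps_nth (P ^ k) (Suc k * m - m)" using Suc assms by simp
  then show ?case
    using nonneg fps_power_nonneg[of P, OF nonneg] by (auto simp: fps_mult_nth intro!: sum_pos2[of _ m])
qed simp

context markov_branching_process
begin

lemma p_add_pos:
  assumes "0 \<le> s" "0 \<le> t" "0 < p s k" "0 < fps_nth (Abs_fps (p t) ^ k) j"
  shows "0 < p (s + t) j"
proof -
  have "0 \<le> p s i * fps_nth (Abs_fps (p t) ^ i) j" for i
    using p_nonneg fps_power_nonneg[of "Abs_fps (p t)" i j] by simp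
  then have "0 < (\<Sum>i. p s i * fps_nth (Abs_fps (p t) ^ i) j)"
    using p_add_sums[OF assms(1,2), of j] assms(3,4) by (intro suminf_pos2[of _ k]) (auto simp: sums_iff)
  then show ?thesis using p_add_sums[OF assms(1,2), of j] by (simp add: sums_iff)
qed

lemma eventually_p_pos:
  assumes "j \<noteq> 1" "0 < rate j"
  shows "eventually (\<lambda>h. 0 < p h j) (at_right 0)"
  using order_tendstoD(1)[OF p_small_time assms(2)] eventually_at_right_less[of "0::real"]
  by eventually_elim (use assms in \<open>auto simp: zero_less_divide_iff\<close>)

text \<open>From index 1 on, a partial sum contains the negative rate \<open>a 1\<close>, which by
  conservativity outweighs all other rates together. This is the sign condition of
  \<open>reciprocal_power_series\<close>.\<close>

lemma partial_rates:
  assumes "0 < n"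
  shows "(\<Sum>i\<le>n. rate i) \<le> 0"
proof -
  have "(\<Sum>i\<in>{..n} \<inter> (insert 0 S - {1}). a i) \<le> - a 1"
    by (rule finite_sum_le_has_sum[OF conservative]) (use rates_nonneg in auto)
  moreover have "(\<Sum>i\<in>{..n} - {1}. rate i) = (\<Sum>i\<in>{..n} \<inter> (insert 0 S - {1}). a i)"
    by (rule sum.mono_neutral_cong_right) (auto simp: rate_def)
  moreover have "(\<Sum>i\<le>n. rate i) = rate 1 + (\<Sum>i\<in>{..n} - {1}. rate i)"
    using assms by (intro sum.remove) auto
  moreover have "rate 1 = a 1" using one_in_S by (simp add: rate_def)
  ultimately show ?thesis by simp
qed

end

context critical_branching
begin

text \<open>Without a nonzero rate at a state of \<open>S\<close> other than 1, criticality would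
  read \<open>a 1 = 0\<close>.\<close>

lemma branching_rate:
  obtains m where "2 \<le> m" "0 < rate m"
proof -
  have "\<exists>m\<in>S. m \<noteq> 1 \<and> a m \<noteq> 0"
  proof (rule ccontr)
    assume "\<not> ?thesis"
    then have "((\<lambda>j. real j * a j) has_sum a 1) S"
      using one_in_S by (intro has_sum_finite_neutralI[of "{1}"]) auto
    then have "a 1 = 0" using crit has_sum_unique unfolding critical_def by blast
    then show False using death_rate by simp
  qed
  then obtain m where m: "m \<in> S" "m \<noteq> 1" "a m \<noteq> 0" by blast
  then have "m \<noteq> 0" using zero_notin_S by metis
  then show ?thesis using m rates_nonneg[of m] by (intro that[of m]) (auto simp: rate_def)
qed

text \<open>In two half steps the process can go from 1 to \<open>n\<close> and from there to
  \<open>n * n\<close>, so arbitrarily large states are reachable at small times. Since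
  \<open>p h 0\<close> and \<open>p h 1\<close> are positive, \<open>n\<close> ancestors can then
  leave any number \<open>j \<le> n\<close>.\<close>

lemma p_pos_exists: "\<exists>t>0. 0 < p t j"
proof -
  have half: "filterlim (\<lambda>h::real. h / 2) (at_right 0) (at_right 0)" by real_asymp
  have p0: "eventually (\<lambda>h. 0 < p h 0) (at_right 0)"
    using death_rate by (intro eventually_p_pos) (auto simp: rate_def)
  have p1: "eventually (\<lambda>h. 0 < p h 1) (at_right 0)"
    using order_tendstoD(1)[OF p_tendsto[of 1], of 0] by simp
  obtain m where m: "2 \<le> m" "0 < rate m" using branching_rate .
  have "\<exists>n\<ge>k. eventually (\<lambda>h. 0 < p h n) (at_right 0)" for k
  proof (induction k)
    case 0
    show ?case using p0 by blast
  next
    case (Suc k)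
    then obtain n where n: "k \<le> n" "eventually (\<lambda>h. 0 < p h n) (at_right 0)" by blast
    show ?case
    \<comment> \<open>Squaring does not move 0 or 1; there the branching rate at
      \<open>m \<ge> 2\<close> starts the growth.\<close>
    proof (cases "n < 2")
      case True
      have "eventually (\<lambda>h. 0 < p h m) (at_right 0)" using m by (intro eventually_p_pos) auto
      then show ?thesis using True n m by (intro exI[of _ m]) auto
    next
      case False
      have "eventually (\<lambda>h. 0 < p h (n * n)) (at_right 0)"
        using eventually_compose_filterlim[OF n(2) half] eventually_at_right_less[of "0::real"]
      proof eventually_elim
        case (elim h)
        have "0 < p (h / 2 + h / 2) (n * n)"
          using elim p_nonneg by (intro p_add_pos[of _ _ n] fps_power_nth_mult_pos) auto
        then show ?case by simp
      qed
      moreover have "Suc k \<le> n * n" using False n by (cases n) auto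
      ultimately show ?thesis by blast
    qed
  qed
  then obtain n where n: "j \<le> n" "eventually (\<lambda>h. 0 < p h n) (at_right 0)" by blast
  have "eventually (\<lambda>h. 0 < h \<and> 0 < p h j) (at_right 0)"
    using eventually_compose_filterlim[OF n(2) half] eventually_compose_filterlim[OF p0 half]
      eventually_compose_filterlim[OF p1 half] eventually_at_right_less[of "0::real"]
  proof eventually_elim
    case (elim h)
    have "0 < p (h / 2 + h / 2) j"
      using elim n p_nonneg by (intro p_add_pos[of _ _ n] fps_power_nth_pos) auto
    then show ?case using elim by simp
  qed
  from eventually_happens'[OF _ this] show ?thesis by auto
qed

text \<open>The weights \<open>j / i\<close> amount to applying \<open>x d/dx\<close> to
  \<open>F t x ^ i\<close> and dividing by \<open>i\<close>.\<close>

lemma Q_row_sums: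
  assumes i: "i \<in> S" and t: "0 \<le> t" and x: "0 < x" "x < 1"
  shows "(\<lambda>j. Q_trans_prob M Z t i j * x ^ j) sums (x * F t x ^ (i - 1) * dF t x)"
proof -
  have i': "i \<in> insert 0 S" and i0: "0 < i" using i zero_notin_S by (blast, metis gr0I)
  define c where "c = trans_prob M Z t i"
  have c_sums: "(\<lambda>j. c j * y ^ j) sums F t y ^ i" if "0 \<le> y" "y \<le> 1" for y
    unfolding c_def by (rule trans_prob_power_sums[OF i' t that])
  have summ: "summable (\<lambda>j. c j * y ^ j)" if "norm y < 1" for y
    by (rule powser_inside[of _ 1]) (use that c_sums[of 1] in \<open>auto simp: sums_iff\<close>)
  have "DERIV (\<lambda>y. \<Sum>j. c j * y ^ j) x :> (\<Sum>n. diffs c n * x ^ n)"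
    by (rule termdiffs_strong'[of 1]) (use summ x in auto)
  moreover have "DERIV (\<lambda>y. \<Sum>j. c j * y ^ j) x :> real i * F t x ^ (i - 1) * dF t x"
  proof (rule has_field_derivative_transform_within_open)
    show "DERIV (\<lambda>y. F t y ^ i) x :> real i * F t x ^ (i - 1) * dF t x"
      using DERIV_power[OF F_space_deriv[OF t, of x], of i] x by (simp add: mult_ac)
    show "open {0<..<1::real}" "x \<in> {0<..<1}" using x by auto
    show "F t y ^ i = (\<Sum>j. c j * y ^ j)" if "y \<in> {0<..<1}" for y
      using sums_unique[OF c_sums[of y]] that by simp
  qed
  ultimately have eq: "(\<Sum>n. diffs c n * x ^ n) = real i * F t x ^ (i - 1) * dF t x" by (rule DERIV_unique)
  have "summable (\<lambda>n. diffs c n * x ^ n)"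
    by (rule termdiff_converges[where K = 1]) (use summ x in auto)
  then have "(\<lambda>n. diffs c n * x ^ n) sums (real i * F t x ^ (i - 1) * dF t x)"
    unfolding eq[symmetric] by (rule summable_sums)
  from sums_divide[OF sums_index_mult[OF this], of "real i"]
  show ?thesis using i0 by (simp add: Q_trans_prob_eq[OF i t] c_def mult_ac)
qed

end

section \<open>The state space of the Q-process and invariance\<close>

locale critical_Q_process =
  critical_branching M Z S a \<nu> \<Lambda> \<Lambda>' \<delta> + Q: markov_Q_process M Z S MW W E
  for M :: "nat \<Rightarrow> 'w measure" and Z S a \<nu> \<Lambda> \<Lambda>' \<delta>
    and MW :: "nat \<Rightarrow> 'v measure" and W :: "real \<Rightarrow> 'v \<Rightarrow> nat" and E
begin

lemma W_trans_prob:
  assumes "j \<in> E" "0 \<le> t"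
  shows "trans_prob MW W t 1 j = real j * p t j"
  using Q.Q_transitions[OF Q.one_in_E assms] Q_trans_prob_eq[of 1 t j] one_in_S assms by (simp add: p_def)

text \<open>The terms \<open>j * p t j\<close> with \<open>j\<close> in \<open>E\<close> already sum
  to 1 as a row of the Q-process; with total mean at most 1, nothing is left for other
  states.\<close>

lemma p_outside_E:
  assumes t: "0 \<le> t" and j: "j \<notin> E" "j \<noteq> 0"
  shows "p t j = 0"
proof -
  have W: "(\<lambda>k. if k \<in> E then real k * p t k else 0) sums 1"
  proof -
    have "trans_prob MW W t 1 k = (if k \<in> E then real k * p t k else 0)" for k
      using W_trans_prob[of k t] Q.trans_prob_outside[OF Q.one_in_E t, of k] t by auto
    then show ?thesis using Q.trans_prob_sums_1[OF Q.one_in_E t] by simp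
  qed
  have "(\<lambda>k. real k * p t k - (if k \<in> E then real k * p t k else 0)) sums ((\<Sum>k. real k * p t k) - 1)"
    by (intro sums_diff W summable_sums mean_le_1 t)
  then have "(\<Sum>k. real k * p t k - (if k \<in> E then real k * p t k else 0)) \<le> 0"
    and s: "summable (\<lambda>k. real k * p t k - (if k \<in> E then real k * p t k else 0))"
    using mean_le_1(2)[OF t] by (auto simp: sums_iff)
  moreover have "real j * p t j - (if j \<in> E then real j * p t j else 0) \<le>
      (\<Sum>k. real k * p t k - (if k \<in> E then real k * p t k else 0))"
    using sum_le_suminf[OF s, of "{j}"] p_nonneg by auto
  ultimately have "real j * p t j \<le> 0" using j by simp
  then show ?thesis using j p_nonneg[of t j] by (simp add: mult_le_0_iff)
qed

lemma E_eq: "E = {0<..}"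
proof -
  have "j \<in> E" if "0 < j" for j
    using p_pos_exists[of j] p_outside_E[of _ j] that by (metis less_imp_le less_irrefl)
  moreover have "0 \<notin> E" using Q.E_subset_S zero_notin_S by blast
  ultimately show ?thesis by (auto intro: gr0I)
qed

lemma positive_states: "0 < i \<Longrightarrow> i \<in> S"
  using E_eq Q.E_subset_S by auto

lemma gen_fun_eq:
  assumes t: "0 \<le> t" and x: "0 \<le> x" "x < 1"
  shows "gen_fun MW W t x = x * (f (F t x) / f x)"
proof -
  interpret W: prob_space "MW 1" using Q.prob_spaces Q.one_in_E by blast
  have "(\<lambda>j. trans_prob MW W t 1 j * x ^ j) sums gen_fun MW W t x"
    unfolding gen_fun_def trans_prob_def
    by (rule W.discrete_expectation_sums[OF Q.random_variables[OF Q.one_in_E t], where B = 1])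
       (use x in \<open>auto simp: power_le_one\<close>)
  moreover have "trans_prob MW W t 1 j = real j * p t j" for j
    using W_trans_prob[of j t] Q.trans_prob_outside[OF Q.one_in_E t, of j] t E_eq by (cases "j = 0") auto
  ultimately have "(\<lambda>j. real j * p t j * x ^ j) sums gen_fun MW W t x" by simp
  moreover have "(\<lambda>j. real j * p t j * x ^ j) sums (x * dF t x)"
    by (rule sums_index_mult, rule dF_sums) (use t x in auto)
  ultimately have "gen_fun MW W t x = x * dF t x" by (rule sums_unique2)
  then show ?thesis using dF_eq[OF t x] f_pos[OF x] by (simp add: field_simps)
qed

lemma invariant_measure:
  assumes c_nonneg: "\<And>n. 0 \<le> c n" and c0: "c 0 = 0"
    and c_sums: "\<And>x. 0 \<le> x \<Longrightarrow> x < 1 \<Longrightarrow> (\<lambda>n. c n * x ^ n) sums (x / f x)"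
    and t: "0 \<le> t" and j: "j \<in> E"
  shows "((\<lambda>i. c i * Q_trans_prob M Z t i j) has_sum c j) E"
proof -
  \<comment> \<open>Row 0 is cleared because the formula for \<open>Q_trans_prob\<close> covers only
    starting states in \<open>S\<close>.\<close>
  define q where "q i k = (if i = 0 then 0 else c i * Q_trans_prob M Z t i k)" for i k
  have q_nonneg: "0 \<le> q i k" for i k
    using Q_trans_prob_eq[OF positive_states t] c_nonneg[of i]
    by (auto simp: q_def trans_prob_nonneg)
  have total: "summable (\<lambda>i. q i k * x ^ k)" "(\<lambda>k. \<Sum>i. q i k * x ^ k) sums (x / f x)"
    if x: "0 < x" "x < 1" for k x
  proof -
    have Fx: "0 < F t x" "0 \<le> F t x" "F t x < 1" using F_ge[of t x] F_less_1[of t x] t x by auto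
    \<comment> \<open>Writing \<open>F^(i-1)\<close> as \<open>F^i / F\<close> exposes a term of the
      series of \<open>c\<close> at the point \<open>F t x\<close>; it requires
      \<open>F t x > 0\<close>, and row 0 fits because \<open>c 0 = 0\<close>.\<close>
    have rows: "(\<lambda>k. q i k * x ^ k) sums (c i * F t x ^ i * (x * dF t x / F t x))" for i
    proof (cases "i = 0")
      case False
      have "F t x ^ i = F t x * F t x ^ (i - 1)" using False by (cases i) auto
      then show ?thesis
        using sums_mult[OF Q_row_sums[OF positive_states[of i] t x], of "c i"] False Fx
        by (simp add: q_def mult_ac)
    qed (simp add: q_def c0)
    have "(\<lambda>i. c i * F t x ^ i * (x * dF t x / F t x)) sums (F t x / f (F t x) * (x * dF t x / F t x))"
      by (intro sums_mult2 c_sums Fx)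
    moreover have "F t x / f (F t x) * (x * dF t x / F t x) = x / f x"
      using dF_eq[OF t, of x] f_pos[OF Fx(2,3)] f_pos[of x] Fx x by (simp add: field_simps)
    ultimately have tot: "(\<lambda>i. c i * F t x ^ i * (x * dF t x / F t x)) sums (x / f x)" by simp
    show "summable (\<lambda>i. q i k * x ^ k)" "(\<lambda>k. \<Sum>i. q i k * x ^ k) sums (x / f x)"
      by (rule sums_swap_nonneg[OF _ rows tot], use q_nonneg x in simp)+
  qed
  have q_summable: "summable (\<lambda>i. q i k)" for k
    using total(1)[of "1/2" k] summable_divide[of "\<lambda>i. q i k * (1/2) ^ k" "(1/2) ^ k"] by simp
  have "(\<lambda>k. (\<Sum>i. q i k) * x ^ k) sums (x / f x)" if "0 < x" "x < 1" for x
    using total(2)[OF that] suminf_mult2[OF q_summable] by simp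
  then have "(\<Sum>i. q i j) = c j"
    by (rule power_series_unique) (use c_sums in auto)
  then have "((\<lambda>i. q i j) has_sum c j) UNIV"
    using q_summable[of j] q_nonneg by (intro sums_nonneg_imp_has_sum) (auto simp: sums_iff)
  then show ?thesis
    by (rule has_sum_cong_neutral[THEN iffD1, rotated -1]) (auto simp: q_def E_eq)
qed

end

text \<open>The norming condition fixes \<open>N\<close> only up to asymptotic equivalence, and a
  change of \<open>N\<close> by a relative amount of order \<open>ln t / t\<close> would alter the
  second-order term of \<open>\<rho>\<close>. Hence the refined claim asks for a norming ratio
  within \<open>o(ln t / t)\<close> of 1, and the last conjunct shows that such a function
  exists.\<close>

theorem theorem3:
  fixes M :: "nat \<Rightarrow> 'w measure" and Z :: "real \<Rightarrow> 'w \<Rightarrow> nat" and S :: "nat set"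
    and a :: "nat \<Rightarrow> real"
    and MW :: "nat \<Rightarrow> 'v measure" and W :: "real \<Rightarrow> 'v \<Rightarrow> nat" and E :: "nat set"
    and \<nu> :: real and \<Lambda> \<Lambda>' \<delta> L N :: "real \<Rightarrow> real"
  assumes mbp: "markov_branching_process M Z S a"
    and critical: "critical S a"
    and nu: "0 < \<nu>" "\<nu> < 1"
    and f_eq: "\<forall>y\<in>{0<..1}. inf_gen_fun S a (1 - y) = y * \<Lambda> y"
    and Lambda_eq: "\<forall>y\<in>{0<..1}. \<Lambda> y = y powr \<nu> * L (1 / y)"
    and L_sv: "slowly_varying L"
    and Lambda_deriv: "\<forall>y\<in>{0<..1}. (\<Lambda> has_real_derivative \<Lambda>' y) (at y within {0<..1})"
    and delta_eq: "\<forall>y\<in>{0<..1}. y * \<Lambda>' y / \<Lambda> y = \<nu> + \<delta> y"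
    and delta_cont: "continuous_on {0<..1} \<delta>"
    and delta_lim: "(\<delta> \<longlongrightarrow> 0) (at_right 0)"
    and N_sv: "slowly_varying N"
    and N_lim: "(norming_ratio \<nu> L N \<longlongrightarrow> 1) at_top"
    and mqp: "markov_Q_process M Z S MW W E"
  shows "\<exists>(\<pi> :: real \<Rightarrow> real) (\<pi>c :: nat \<Rightarrow> real) (\<rho> :: real \<Rightarrow> real \<Rightarrow> real).
      (\<forall>t>0. \<forall>s\<in>{0..<1}.
         (\<nu> * t) powr (1 + 1 / \<nu>) * gen_fun MW W t s = \<pi> s * N t * (1 + \<rho> t s)) \<and>
      (\<forall>s\<in>{0..<1}. ((\<lambda>j. \<pi>c j * s ^ j) has_sum \<pi> s) E) \<and>
      (\<forall>j\<in>E. 0 \<le> \<pi>c j) \<and>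
      (\<forall>t\<ge>0. \<forall>j\<in>E. ((\<lambda>i. \<pi>c i * Q_trans_prob M Z t i j) has_sum \<pi>c j) E) \<and>
      (\<forall>s\<in>{0..<1}. \<pi> s = s / (1 - s) powr (1 + \<nu>) * (1 / L (1 / (1 - s)))) \<and>
      (\<forall>s\<in>{0..<1}. ((\<lambda>t. \<rho> t s) \<longlongrightarrow> 0) at_top) \<and>
      ((\<forall>y\<in>{0<..1}. \<delta> y = \<Lambda> y) \<longrightarrow>
         ((\<lambda>t. norming_ratio \<nu> L N t - 1) \<in> o(\<lambda>t. ln t / t) \<longrightarrow>
            (\<forall>s\<in>{0..<1}.
               (\<lambda>t. \<rho> t s - (- ((1 + \<nu>) / \<nu> ^ 3) * (ln (\<Lambda> (1 - s) * \<nu> * t + 1) / t)))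
                 \<in> o(\<lambda>t. ln t / t))) \<and>
         (\<exists>N'. slowly_varying N' \<and>
            (\<lambda>t. norming_ratio \<nu> L N' t - 1) \<in> o(\<lambda>t. ln t / t)))"
proof -
  have L_pos: "0 < L x" if "0 < x" for x using L_sv that by (rule slowly_varying_pos)
  have rate_pos: "0 < \<Lambda> y" if "y \<in> {0<..1}" for y
    using Lambda_eq L_pos that by auto
  interpret regular_rate \<nu> \<Lambda> \<Lambda>' \<delta>
    by unfold_locales (use nu rate_pos Lambda_deriv delta_eq delta_lim in blast)+
  interpret markov_branching_process M Z S a by (rule mbp)
  interpret markov_Q_process M Z S MW W E by (rule mqp)
  interpret B: critical_Q_process M Z S a \<nu> \<Lambda> \<Lambda>' \<delta> MW W E
    by unfold_locales (use critical f_eq in blast)+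
  interpret norming \<nu> \<Lambda> \<Lambda>' \<delta> L N
    by unfold_locales (use nu L_pos Lambda_eq N_sv N_lim in blast)+
  have decay: "normed_decay \<nu> \<Lambda> \<Lambda>' \<delta> L N (\<lambda>t. 1 - F t s)" if "s \<in> {0..<1}" for s
    by (intro normed_decay.intro norming_axioms B.rate_decay_F) (use that in auto)
  define \<pi> where "\<pi> s = s / (1 - s) powr (1 + \<nu>) * (1 / L (1 / (1 - s)))" for s
  define \<rho> where "\<rho> t s = (1 - F t s) / scale t * (\<nu> * t * \<Lambda> (1 - F t s)) - 1" for t s
  have \<rho>_eq: "(\<lambda>t. \<rho> t s) = normed_decay.remainder \<nu> \<Lambda> N (\<lambda>t. 1 - F t s)" if "s \<in> {0..<1}" for s
    using normed_decay.remainder_def[OF decay[OF that]] by (auto simp: \<rho>_def)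
  have \<pi>_eq: "\<pi> s = s / f s" if "s \<in> {0..<1}" for s
  proof -
    have "f s = (1 - s) * ((1 - s) powr \<nu> * L (1 / (1 - s)))"
      using B.f_rate[of s] Lambda_eq that by simp
    also have "\<dots> = (1 - s) powr (1 + \<nu>) * L (1 / (1 - s))" using that by (simp add: powr_add)
    finally show ?thesis by (simp add: \<pi>_def)
  qed
  obtain c where c: "\<And>n. 0 < c n" "\<And>x. 0 \<le> x \<Longrightarrow> x < 1 \<Longrightarrow> (\<lambda>n. c n * x ^ n) sums (1 / f x)"
  proof (rule reciprocal_power_series[of rate f])
    show "0 < rate 0" using death_rate by (simp add: rate_def)
    show "(\<lambda>j. rate j * x ^ j) sums f x" "summable (\<lambda>j. \<bar>rate j * x ^ j\<bar>)" if "0 \<le> x" "x < 1" for x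
      unfolding f_def using rate_summable[of x] that by (auto intro: summable_sums)
  qed (use partial_rates B.f_pos in blast)+
  \<comment> \<open>The factor \<open>x\<close> in \<open>x / f x\<close> shifts the coefficients of
    \<open>1 / f\<close> by one and leaves 0 at index 0.\<close>
  define \<pi>c where "\<pi>c j = (if j = 0 then 0 else c (j - 1))" for j
  have \<pi>c_sums: "(\<lambda>j. \<pi>c j * x ^ j) sums (x / f x)" if "0 \<le> x" "x < 1" for x
  proof -
    have "(\<lambda>j. \<pi>c (Suc j) * x ^ Suc j) sums (x * (1 / f x))"
      using sums_mult[OF c(2)[OF that], of x] by (simp add: \<pi>c_def mult_ac)
    then show ?thesis using sums_Suc_iff[of "\<lambda>j. \<pi>c j * x ^ j"] by (simp add: \<pi>c_def)
  qed
  have \<pi>c_nonneg: "0 \<le> \<pi>c j" for j using c(1) by (simp add: \<pi>c_def less_imp_le)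
  show ?thesis
  proof (rule exI[of _ \<pi>], rule exI[of _ \<pi>c], rule exI[of _ \<rho>], intro conjI impI allI ballI)
    fix t s :: real assume t: "0 < t" and s: "s \<in> {0..<1}"
    have N: "0 < N t" using N_sv t by (rule slowly_varying_pos)
    define R where "R = 1 - F t s"
    have "f (F t s) = R * \<Lambda> R"
      using B.f_rate[of "F t s"] F_less_1[of t s] F_nonneg[of t s] t s by (simp add: R_def)
    then have G: "gen_fun MW W t s = s * (R * \<Lambda> R / f s)" using B.gen_fun_eq[of t s] t s by simp
    define P where "P = (\<nu> * t) powr (1 / \<nu>)"
    have P: "(\<nu> * t) powr (1 + 1 / \<nu>) = \<nu> * t * P" "0 < P"
      using t nu by (auto simp: P_def powr_add)
    have \<rho>: "1 + \<rho> t s = R / (N t / P) * (\<nu> * t * \<Lambda> R)" by (simp add: \<rho>_def scale_def R_def P_def)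
    have "0 < f s" using B.f_pos s by simp
    then show "(\<nu> * t) powr (1 + 1 / \<nu>) * gen_fun MW W t s = \<pi> s * N t * (1 + \<rho> t s)"
      unfolding G P(1) \<pi>_eq[OF s] \<rho> using N P(2) by (simp add: field_simps)
  next
    fix s :: real assume s: "s \<in> {0..<1}"
    have "((\<lambda>j. \<pi>c j * s ^ j) has_sum \<pi> s) UNIV"
      using \<pi>c_sums[of s] \<pi>c_nonneg s by (intro sums_nonneg_imp_has_sum) (auto simp: \<pi>_eq)
    then show "((\<lambda>j. \<pi>c j * s ^ j) has_sum \<pi> s) E"
      by (rule has_sum_cong_neutral[THEN iffD1, rotated -1]) (auto simp: \<pi>c_def B.E_eq)
    show "\<pi> s = s / (1 - s) powr (1 + \<nu>) * (1 / L (1 / (1 - s)))" by (simp add: \<pi>_def)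
    show "((\<lambda>t. \<rho> t s) \<longlongrightarrow> 0) at_top"
      unfolding \<rho>_eq[OF s] by (rule normed_decay.remainder_tendsto_0[OF decay[OF s]])
  next
    fix j
    show "0 \<le> \<pi>c j" by (rule \<pi>c_nonneg)
  next
    fix t :: real and j assume "0 \<le> t" "j \<in> E"
    then show "((\<lambda>i. \<pi>c i * Q_trans_prob M Z t i j) has_sum \<pi>c j) E"
      by (intro B.invariant_measure \<pi>c_nonneg \<pi>c_sums) (simp add: \<pi>c_def)
  next
    fix s :: real
    assume d: "\<forall>y\<in>{0<..1}. \<delta> y = \<Lambda> y" and N: "(\<lambda>t. norming_ratio \<nu> L N t - 1) \<in> o(\<lambda>t. ln t / t)"
      and s: "s \<in> {0..<1}"
    show "(\<lambda>t. \<rho> t s - (- ((1 + \<nu>) / \<nu> ^ 3) * (ln (\<Lambda> (1 - s) * \<nu> * t + 1) / t))) \<in> o(\<lambda>t. ln t / t)"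
      using normed_decay.remainder_second_order[OF decay[OF s] _ N, of "\<Lambda> (1 - s)"] d s rate_pos[of "1 - s"]
      unfolding \<rho>_eq[OF s, symmetric] by auto
  next
    assume d: "\<forall>y\<in>{0<..1}. \<delta> y = \<Lambda> y"
    obtain C where "0 < C" "(\<lambda>t. norming_ratio \<nu> L (\<lambda>_. C) t - 1) \<in> o(\<lambda>t. ln t / t)"
      using constant_norming[of L] Lambda_eq d by blast
    moreover have "slowly_varying (\<lambda>_. C)" if "0 < C" for C
      using that by (simp add: slowly_varying_def)
    ultimately show "\<exists>N'. slowly_varying N' \<and> (\<lambda>t. norming_ratio \<nu> L N' t - 1) \<in> o(\<lambda>t. ln t / t)"
      by blast
  qed
qed

end
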